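(* Let $(X,T)$ be a topological dynamical system. (i) If $K\subseteq X$ is non-empty and compact, then $$h_{\rm top}^B(T,K)=\sup\{\underline{h}_\mu(T):\ \mu\in M(X),\ \mu(K)=1\}.$$ (ii) Assume that $h_{\rm top}(T)<\infty$. If $Z\subseteq X$ is analytic, then $$h_{\rm top}^B(T,Z)=\sup\{h_{\rm top}^B(T,K):\ K\subseteq Z \text{ is compact}\}.$$
   Context: A topological dynamical system (TDS) $(X,T)$ is a compact metric space $X$ with a continuous map $T:X\to X$. Fix a compatible metric $d$ on $X$. $M(X)$ is the set of all Borel probability measures on $X$. For $n\in\mathbb{N}=\{1,2,\dots\}$ let $d_n(x,y)=\max\{d(T^kx,T^ky):0\le k\le n-1\}$ and $B_n(x,\epsilon)=\{y\in X: d_n(x,y)<\epsilon\}$. Measure-theoretical lower entropy of $\mu\in M(X)$: $\underline{h}_\mu(T)=\int \underline{h}_\mu(T,x)\,d\mu(x)$, where $\underline{h}_\mu(T,x)=\lim_{\epsilon\to0}\liminf_{n\to\infty}-\frac1n\log\mu(B_n(x,\epsilon))$ (values in $[0,\infty]$). Bowen's topological entropy: for $Z\subseteq X$, $s\ge0$, $N\in\mathbb{N}$, $\epsilon>0$, let $\mathcal{M}^s_{N,\epsilon}(Z)=\inf\sum_i e^{-sn_i}$, the infimum over all finite or countable families $\{B_{n_i}(x_i,\epsilon)\}$ with $x_i\in X$, $n_i\ge N$ and $\bigcup_iB_{n_i}(x_i,\epsilon)\supseteq Z$. Let $\mathcal{M}^s_\epsilon(Z)=\lim_{N\to\infty}\mathcal{M}^s_{N,\epsilon}(Z)$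 and $\mathcal{M}^s(Z)=\lim_{\epsilon\to0}\mathcal{M}^s_\epsilon(Z)$ (monotone limits). Then $h_{\rm top}^B(T,Z)\in[0,\infty]$ is the critical value of $s$ at which $\mathcal{M}^s(Z)$ jumps from $\infty$ to $0$, i.e. $h_{\rm top}^B(T,Z)=\inf\{s\ge 0:\mathcal{M}^s(Z)=0\}$ (with $\inf\emptyset=\infty$). $h_{\rm top}(T)$ is the usual topological entropy of $(X,T)$: $h_{\rm top}(T)=\lim_{\epsilon\to0}\limsup_{n\to\infty}\frac1n\log r_n(X,\epsilon)$, where $r_n(X,\epsilon)$ is the largest cardinality of a set $E\subseteq X$ with $d_n(x,y)>\epsilon$ for all distinct $x,y\in E$. A set in a metric space is analytic if it is a continuous image of the space $\mathcal{N}$ of infinite sequences of natural numbers with its product topology. *)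

theory Defs
  imports "HOL-Probability.Probability"
begin

(* The compact metric space is a compact set X in an ambient metric type, with the metric
   dist restricted to X; values of T outside X play no role. *)
definition tds :: "'a::metric_space set \<Rightarrow> ('a \<Rightarrow> 'a) \<Rightarrow> bool" where
  "tds X T \<longleftrightarrow> compact X \<and> continuous_on X T \<and> T ` X \<subseteq> X"

(* Meaningful for n \<ge> 1 only: for n = 0 this is the maximum of the empty set. *)
definition bowen_dist :: "('a::metric_space \<Rightarrow> 'a) \<Rightarrow> nat \<Rightarrow> 'a \<Rightarrow> 'a \<Rightarrow> real" where
  "bowen_dist T n x y = (MAX k\<in>{..<n}. dist ((T ^^ k) x) ((T ^^ k) y))"

definition bowen_ball ::
  "'a::metric_space set \<Rightarrow> ('a \<Rightarrow> 'a) \<Rightarrow> nat \<Rightarrow> 'a \<Rightarrow> real \<Rightarrow> 'a set" where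
  "bowen_ball X T n x \<epsilon> = {y \<in> X. bowen_dist T n x y < \<epsilon>}"

definition borel_prob_measures :: "'a::metric_space set \<Rightarrow> 'a measure set" where
  "borel_prob_measures X = {\<mu>. prob_space \<mu> \<and> sets \<mu> = sets (restrict_space borel X)}"

(* - (1/n) log p for a probability p, with - log 0 = \<infinity>. *)
definition log_decay_rate :: "nat \<Rightarrow> real \<Rightarrow> ennreal" where
  "log_decay_rate n p = (if p = 0 then \<infinity> else ennreal (- (1 / real n) * ln p))"

(* The limits as \<epsilon> \<rightarrow> 0 and N \<rightarrow> \<infinity> below are limits of monotone functions, so they exist in
   ennreal. *)
definition local_lower_entropy ::
  "'a::metric_space set \<Rightarrow> ('a \<Rightarrow> 'a) \<Rightarrow> 'a measure \<Rightarrow> 'a \<Rightarrow> ennreal" where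
  "local_lower_entropy X T \<mu> x =
     Lim (at_right 0) (\<lambda>\<epsilon>::real.
       liminf (\<lambda>n. log_decay_rate n (measure \<mu> (bowen_ball X T n x \<epsilon>))))"

definition lower_entropy ::
  "'a::metric_space set \<Rightarrow> ('a \<Rightarrow> 'a) \<Rightarrow> 'a measure \<Rightarrow> ennreal" where
  "lower_entropy X T \<mu> = (\<integral>\<^sup>+ x. local_lower_entropy X T \<mu> x \<partial>\<mu>)"

(* A finite or countable family of Bowen balls is indexed by a set I of natural numbers. *)
definition bowen_premeasure ::
  "'a::metric_space set \<Rightarrow> ('a \<Rightarrow> 'a) \<Rightarrow> real \<Rightarrow> nat \<Rightarrow> real \<Rightarrow> 'a set \<Rightarrow> ennreal" where
  "bowen_premeasure X T s N \<epsilon> Z =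
     Inf {(\<Sum>\<^sub>\<infinity>i\<in>I. ennreal (exp (- s * real (n i)))) | (I :: nat set) n x.
            (\<forall>i\<in>I. x i \<in> X \<and> n i \<ge> N) \<and> Z \<subseteq> (\<Union>i\<in>I. bowen_ball X T (n i) (x i) \<epsilon>)}"

definition bowen_measure_eps ::
  "'a::metric_space set \<Rightarrow> ('a \<Rightarrow> 'a) \<Rightarrow> real \<Rightarrow> real \<Rightarrow> 'a set \<Rightarrow> ennreal" where
  "bowen_measure_eps X T s \<epsilon> Z = Lim sequentially (\<lambda>N. bowen_premeasure X T s N \<epsilon> Z)"

definition bowen_measure ::
  "'a::metric_space set \<Rightarrow> ('a \<Rightarrow> 'a) \<Rightarrow> real \<Rightarrow> 'a set \<Rightarrow> ennreal" where
  "bowen_measure X T s Z = Lim (at_right 0) (\<lambda>\<epsilon>. bowen_measure_eps X T s \<epsilon> Z)"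

definition bowen_entropy :: "'a::metric_space set \<Rightarrow> ('a \<Rightarrow> 'a) \<Rightarrow> 'a set \<Rightarrow> ennreal" where
  "bowen_entropy X T Z = Inf {ennreal s | s. s \<ge> 0 \<and> bowen_measure X T s Z = 0}"

(* For compact X, continuous T and \<epsilon> > 0 the separated sets have bounded finite cardinality,
   so the maximum exists. *)
definition max_separated ::
  "'a::metric_space set \<Rightarrow> ('a \<Rightarrow> 'a) \<Rightarrow> nat \<Rightarrow> real \<Rightarrow> nat" where
  "max_separated X T n \<epsilon> =
     Max {card E | E. finite E \<and> E \<subseteq> X \<and> (\<forall>x\<in>E. \<forall>y\<in>E. x \<noteq> y \<longrightarrow> bowen_dist T n x y > \<epsilon>)}"

definition top_entropy :: "'a::metric_space set \<Rightarrow> ('a \<Rightarrow> 'a) \<Rightarrow> ennreal" where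
  "top_entropy X T =
     Lim (at_right 0) (\<lambda>\<epsilon>::real.
       limsup (\<lambda>n. ennreal (1 / real n * ln (real (max_separated X T n \<epsilon>)))))"

(* nat carries the discrete topology and nat \<Rightarrow> nat the product topology. *)
definition analytic_set :: "'a::metric_space set \<Rightarrow> bool" where
  "analytic_set Z \<longleftrightarrow> (\<exists>f :: (nat \<Rightarrow> nat) \<Rightarrow> 'a. continuous_on UNIV f \<and> Z = range f)"

end

theory Submission
  imports Defs
begin

text \<open>
  Both statements rest on the geometry of the premeasures
  \<^const>\<open>bowen_premeasure\<close> at a fixed scale, and on compactness.

  For a compact set \<open>K\<close>, the entropy of a measure carried by \<open>K\<close> is bounded by the mass distribution
  principle (\<open>mass_distribution_null\<close>): where the mass of Bowen balls decays faster than
  \<open>exp (- s n)\<close>, a set with arbitrarily cheap covers is null. For the converse one needs, for every \<open>s\<close> below the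
  entropy of \<open>K\<close>, a probability on \<open>K\<close> giving every ball of time \<open>n\<close> mass at most a constant
  times \<open>exp (- s n)\<close>. Given finitely many balls, mass is spread greedily over \<open>K\<close> subject to these
  bounds until every point lies in a ball whose bound is attained. Such balls cover \<open>K\<close>,
  and a Vitali selection (\<open>vitali_bowen_balls\<close>), in which time replaces the radius,
  extracts disjoint ones that still cover \<open>K\<close> after tripling the radius; hence the total mass
  reaches any prescribed value up to the premeasure of \<open>K\<close>, whatever the given balls are
  (\<open>finite_frostman\<close>).
  Tychonoff's theorem yields a finitely additive probability that obeys all bounds, and an outer
  measure built from its values on compact sets turns it into a Borel measure that is no larger on
  open sets (\<open>borel_measure_below_finitely_additive\<close>).

  For an analytic set, the net content of covers by balls with centres in finite nets
  passes to increasing unions at an arbitrarily small loss in the exponent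
  (\<open>content_increasing_union\<close>): a cluster point of covers of the members is again cheap, and what it
  misses can be covered at arbitrarily high times at bounded cost, hence at no cost once the exponent
  is raised. The classical capacitability construction then applies along a decreasing sequence
  of exponents and produces a compact subset of positive content (\<open>content_analytic\<close>).
\<close>

section \<open>Sums of extended nonnegative weights over arbitrary index sets\<close>

lemma infsum_ennreal_SUP:
  "infsum (f :: 'i \<Rightarrow> ennreal) A = (SUP F\<in>{F. finite F \<and> F \<subseteq> A}. sum f F)"
  by (rule nonneg_infsum_complete) simp

lemma infsum_ennreal_leI:
  assumes "\<And>F. finite F \<Longrightarrow> F \<subseteq> A \<Longrightarrow> sum f F \<le> (c :: ennreal)"
  shows "infsum f A \<le> c"
  unfolding infsum_ennreal_SUP using assms by (auto intro!: SUP_least)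

lemma sum_le_infsum_ennreal:
  assumes "finite F" "F \<subseteq> A"
  shows "sum f F \<le> infsum (f :: 'i \<Rightarrow> ennreal) A"
  unfolding infsum_ennreal_SUP using assms by (auto intro!: SUP_upper)

lemma infsum_ennreal_mono_set:
  assumes "A \<subseteq> B"
  shows "infsum f A \<le> infsum (f :: 'i \<Rightarrow> ennreal) B"
  using assms by (intro infsum_ennreal_leI sum_le_infsum_ennreal) auto

lemma infsum_ennreal_mono:
  assumes "\<And>i. i \<in> A \<Longrightarrow> f i \<le> g i"
  shows "infsum f A \<le> infsum (g :: 'i \<Rightarrow> ennreal) A"
proof (rule infsum_ennreal_leI)
  fix F assume F: "finite F" "F \<subseteq> A"
  have "sum f F \<le> sum g F" using F assms by (intro sum_mono) auto
  also have "\<dots> \<le> infsum g A" using F by (rule sum_le_infsum_ennreal)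
  finally show "sum f F \<le> infsum g A" .
qed

text \<open>Several indices may be sent to the same image point, whose weight is then counted only once on
  the left.\<close>

lemma infsum_ennreal_image_le:
  "infsum f (g ` A) \<le> infsum (\<lambda>i. f (g i) :: ennreal) A"
proof (rule infsum_ennreal_leI)
  fix F assume F: "finite F" "F \<subseteq> g ` A"
  then obtain C where C: "C \<subseteq> A" "finite C" "F = g ` C" "inj_on g C"
    by (metis finite_imageD subset_image_inj)
  then have "sum f F = sum (\<lambda>i. f (g i)) C" by (simp add: sum.reindex)
  also have "\<dots> \<le> infsum (\<lambda>i. f (g i)) A" using C by (intro sum_le_infsum_ennreal)
  finally show "sum f F \<le> infsum (\<lambda>i. f (g i)) A" .
qed

lemma infsum_ennreal_Un_le:
  "infsum f (A \<union> B) \<le> infsum f A + infsum (f :: 'i \<Rightarrow> ennreal) B"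
proof (rule infsum_ennreal_leI)
  fix F assume F: "finite F" "F \<subseteq> A \<union> B"
  have "sum f F = sum f (F \<inter> A) + sum f (F - A)"
    using F(1) by (metis add.commute sum.Int_Diff)
  also have "\<dots> \<le> infsum f A + infsum f B"
    using F by (intro add_mono sum_le_infsum_ennreal) auto
  finally show "sum f F \<le> infsum f A + infsum f B" .
qed

lemma infsum_ennreal_UN_le:
  fixes f :: "'i \<Rightarrow> ennreal" and G :: "nat \<Rightarrow> 'i set"
  shows "infsum f (\<Union>j. G j) \<le> (\<Sum>j. infsum f (G j))"
proof (rule infsum_ennreal_leI)
  fix F assume F: "finite F" "F \<subseteq> (\<Union>j. G j)"
  then obtain j where "\<And>x. x \<in> F \<Longrightarrow> x \<in> G (j x)" by (metis UN_E subset_iff)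
  then have J: "finite (j ` F)" "F \<subseteq> (\<Union>i\<in>j ` F. G i)" using F by auto
  have *: "infsum f (\<Union>i\<in>J. G i) \<le> (\<Sum>i\<in>J. infsum f (G i))" if "finite J" for J
    using that
  proof induction
    case (insert j J)
    have "infsum f (\<Union>i\<in>insert j J. G i) \<le> infsum f (G j) + infsum f (\<Union>i\<in>J. G i)"
      using infsum_ennreal_Un_le by simp
    then show ?case using insert by (simp add: add_left_mono order_trans)
  qed simp
  have "sum f F \<le> infsum f (\<Union>i\<in>j ` F. G i)" using F J by (intro sum_le_infsum_ennreal)
  also note *[OF J(1)]
  also have "(\<Sum>i\<in>j ` F. infsum f (G i)) \<le> (\<Sum>j. infsum f (G j))"
    using J(1) by (intro sum_le_suminf) auto
  finally show "sum f F \<le> (\<Sum>j. infsum f (G j))" .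
qed

lemma emeasure_UN_le_infsum:
  fixes I :: "nat set"
  assumes "\<And>i. i \<in> I \<Longrightarrow> B i \<in> sets M"
  shows "emeasure M (\<Union>i\<in>I. B i) \<le> infsum (\<lambda>i. emeasure M (B i)) I"
proof -
  define C where "C i = (if i \<in> I then B i else {})" for i
  have "emeasure M (\<Union>i. C i) \<le> (\<Sum>i. emeasure M (C i))"
    using assms by (intro emeasure_subadditive_countably) (auto simp: C_def)
  also have "\<dots> \<le> infsum (\<lambda>i. emeasure M (B i)) I"
    unfolding suminf_eq_SUP
  proof (rule SUP_least)
    fix n
    have "(\<Sum>i<n. emeasure M (C i)) = (\<Sum>i\<in>{..<n} \<inter> I. emeasure M (B i))"
      unfolding C_def by (subst sum.inter_restrict) (auto intro!: sum.cong)
    also have "\<dots> \<le> infsum (\<lambda>i. emeasure M (B i)) I" by (intro sum_le_infsum_ennreal) auto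
    finally show "(\<Sum>i<n. emeasure M (C i)) \<le> infsum (\<lambda>i. emeasure M (B i)) I" .
  qed
  also have "(\<Union>i. C i) = (\<Union>i\<in>I. B i)" by (auto simp: C_def split: if_splits)
  finally show ?thesis .
qed

lemma suminf_ennreal_half_powers:
  assumes "0 \<le> e"
  shows "(\<Sum>i. ennreal (e * (1/2) ^ Suc i)) = ennreal e"
proof -
  have "(\<lambda>i. e * (1/2) ^ Suc i) sums e" using sums_mult[OF power_half_series, of e] by simp
  then show ?thesis using assms by (intro suminf_ennreal_eq) auto
qed

lemma Lim_at_right_0_antimono:
  fixes g :: "real \<Rightarrow> ennreal"
  assumes "\<And>a b. 0 < a \<Longrightarrow> a \<le> b \<Longrightarrow> g b \<le> g a"
  shows "Lim (at_right 0) g = (SUP \<epsilon>\<in>{0<..}. g \<epsilon>)"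
proof (rule tendsto_Lim)
  show "(g \<longlongrightarrow> (SUP \<epsilon>\<in>{0<..}. g \<epsilon>)) (at_right 0)"
  proof (rule order_tendstoI)
    fix y assume "y < (SUP \<epsilon>\<in>{0<..}. g \<epsilon>)"
    then obtain e where e: "e > 0" "y < g e" by (auto simp: less_SUP_iff)
    have "\<forall>\<^sub>F x in at_right 0. x < e" using e by (intro eventually_at_rightI[of 0 e]) auto
    moreover have "\<forall>\<^sub>F x::real in at_right 0. 0 < x" by (rule eventually_at_right_less)
    ultimately show "\<forall>\<^sub>F x in at_right 0. y < g x"
      by eventually_elim (metis assms e(2) less_imp_le order_less_le_trans)
  next
    fix y assume y: "(SUP \<epsilon>\<in>{0<..}. g \<epsilon>) < y"
    have "\<forall>\<^sub>F x::real in at_right 0. 0 < x" by (rule eventually_at_right_less)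
    then show "\<forall>\<^sub>F x in at_right 0. g x < y"
      by eventually_elim (metis SUP_upper greaterThan_iff order_le_less_trans y)
  qed
qed simp

section \<open>Bowen balls\<close>

lemma mem_bowen_ball:
  assumes "n \<ge> 1"
  shows "y \<in> bowen_ball X T n x \<epsilon> \<longleftrightarrow>
    y \<in> X \<and> (\<forall>k<n. dist ((T ^^ k) x) ((T ^^ k) y) < \<epsilon>)"
proof -
  have "{..<n} \<noteq> {}" using assms by (auto simp: lessThan_empty_iff)
  then show ?thesis by (auto simp: bowen_ball_def bowen_dist_def)
qed

lemma bowen_ball_mono: "\<epsilon> \<le> \<delta> \<Longrightarrow> bowen_ball X T n x \<epsilon> \<subseteq> bowen_ball X T n x \<delta>"
  by (auto simp: bowen_ball_def)

lemma bowen_ball_subset: "bowen_ball X T n x \<epsilon> \<subseteq> X"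
  by (auto simp: bowen_ball_def)

lemma centre_in_bowen_ball: "n \<ge> 1 \<Longrightarrow> x \<in> X \<Longrightarrow> \<epsilon> > 0 \<Longrightarrow> x \<in> bowen_ball X T n x \<epsilon>"
  by (simp add: mem_bowen_ball)

text \<open>Any ball may be replaced by a ball of twice the radius around one of its points. This is used to
  move centres into the set under study, or into a finite net.\<close>

lemma bowen_ball_subset_recentred:
  assumes "n \<ge> 1" "y \<in> bowen_ball X T n x \<epsilon>"
  shows "bowen_ball X T n x \<epsilon> \<subseteq> bowen_ball X T n y (2 * \<epsilon>)"
proof
  fix z assume z: "z \<in> bowen_ball X T n x \<epsilon>"
  have "dist ((T ^^ k) y) ((T ^^ k) z) < 2 * \<epsilon>" if "k < n" for k
  proof -
    have "dist ((T ^^ k) y) ((T ^^ k) z) \<le> dist ((T ^^ k) x) ((T ^^ k) y) + dist ((T ^^ k) x) ((T ^^ k) z)"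
      by (metis dist_commute dist_triangle)
    moreover have "dist ((T ^^ k) x) ((T ^^ k) y) < \<epsilon>" "dist ((T ^^ k) x) ((T ^^ k) z) < \<epsilon>"
      using that assms z by (auto simp: mem_bowen_ball)
    ultimately show ?thesis by linarith
  qed
  then show "z \<in> bowen_ball X T n y (2 * \<epsilon>)" using assms z by (auto simp: mem_bowen_ball)
qed

text \<open>The engulfing property behind the Vitali covering argument. Bowen balls are not nested, but
  a longer orbit segment gives a more restrictive metric, so the ball with the larger time plays
  the part of the smaller ball.\<close>

lemma bowen_ball_engulf:
  assumes "1 \<le> n" "n \<le> m" "bowen_ball X T n x \<epsilon> \<inter> bowen_ball X T m z \<epsilon> \<noteq> {}"
  shows "bowen_ball X T m z \<epsilon> \<subseteq> bowen_ball X T n x (3 * \<epsilon>)"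
proof
  from assms obtain w where w: "w \<in> bowen_ball X T n x \<epsilon>" "w \<in> bowen_ball X T m z \<epsilon>" by auto
  fix y assume y: "y \<in> bowen_ball X T m z \<epsilon>"
  have "dist ((T ^^ k) x) ((T ^^ k) y) < 3 * \<epsilon>" if "k < n" for k
  proof -
    have "dist ((T ^^ k) x) ((T ^^ k) w) < \<epsilon>" "dist ((T ^^ k) z) ((T ^^ k) w) < \<epsilon>"
      "dist ((T ^^ k) z) ((T ^^ k) y) < \<epsilon>"
      using that assms w y by (auto simp: mem_bowen_ball)
    moreover have "dist ((T ^^ k) x) ((T ^^ k) y) \<le> dist ((T ^^ k) x) ((T ^^ k) w) + dist ((T ^^ k) w) ((T ^^ k) y)"
      by (rule dist_triangle)
    moreover have "dist ((T ^^ k) w) ((T ^^ k) y) \<le> dist ((T ^^ k) z) ((T ^^ k) w) + dist ((T ^^ k) z) ((T ^^ k) y)"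
      by (metis dist_commute dist_triangle)
    ultimately show ?thesis by linarith
  qed
  then show "y \<in> bowen_ball X T n x (3 * \<epsilon>)" using assms y by (auto simp: mem_bowen_ball)
qed

lemma tds_funpow:
  assumes "tds X T"
  shows "continuous_on X (T ^^ k)" "(T ^^ k) ` X \<subseteq> X"
proof -
  have "continuous_on X (T ^^ k) \<and> (T ^^ k) ` X \<subseteq> X"
  proof (induction k)
    case (Suc k)
    have T: "continuous_on X T" "T ` X \<subseteq> X" using assms by (auto simp: tds_def)
    then have "continuous_on X (T \<circ> (T ^^ k))"
      using Suc by (metis continuous_on_compose continuous_on_subset)
    moreover have "(T \<circ> (T ^^ k)) ` X \<subseteq> X" using T Suc by fastforce
    ultimately show ?case by simp
  qed (auto simp: id_def)
  then show "continuous_on X (T ^^ k)" "(T ^^ k) ` X \<subseteq> X" by auto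
qed

lemma openin_bowen_ball:
  assumes "tds X T" "n \<ge> 1"
  shows "openin (top_of_set X) (bowen_ball X T n x \<epsilon>)"
proof -
  have "openin (top_of_set X) (X \<inter> (\<lambda>y. dist ((T ^^ k) x) ((T ^^ k) y)) -` {..<\<epsilon>})" for k
    using tds_funpow(1)[OF assms(1)]
    by (intro continuous_openin_preimage_gen continuous_on_dist continuous_on_const) auto
  then have "openin (top_of_set X) (\<Inter>k\<in>{..<n}. X \<inter> (\<lambda>y. dist ((T ^^ k) x) ((T ^^ k) y)) -` {..<\<epsilon>})"
    using assms(2) by (intro openin_INT2) (auto simp: lessThan_empty_iff)
  also have "(\<Inter>k\<in>{..<n}. X \<inter> (\<lambda>y. dist ((T ^^ k) x) ((T ^^ k) y)) -` {..<\<epsilon>}) = bowen_ball X T n x \<epsilon>"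
    using assms(2) by (auto simp: mem_bowen_ball lessThan_empty_iff)
  finally show ?thesis .
qed

section \<open>Elementary properties of Bowen entropy\<close>

text \<open>The definition indexes covers by sets of natural numbers; covers indexed by any countable set,
  such as a set of pairs of a time and a centre, are equally good.\<close>

lemma bowen_premeasure_le:
  assumes "countable J" "\<And>j. j \<in> J \<Longrightarrow> x j \<in> X" "\<And>j. j \<in> J \<Longrightarrow> n j \<ge> N"
    and "Z \<subseteq> (\<Union>j\<in>J. bowen_ball X T (n j) (x j) \<epsilon>)"
  shows "bowen_premeasure X T s N \<epsilon> Z \<le> infsum (\<lambda>j. ennreal (exp (- s * real (n j)))) J"
proof -
  obtain I :: "nat set" and g where inj: "inj_on g I" and img: "g ` I = J"
    using assms(1) unfolding countable_as_injective_image_subset by metis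
  have "bowen_premeasure X T s N \<epsilon> Z \<le> infsum (\<lambda>i. ennreal (exp (- s * real (n (g i))))) I"
    unfolding bowen_premeasure_def
  proof (rule Inf_lower, intro CollectI exI conjI)
    show "\<forall>i\<in>I. x (g i) \<in> X \<and> N \<le> n (g i)" using assms(2,3) img by blast
    show "Z \<subseteq> (\<Union>i\<in>I. bowen_ball X T (n (g i)) (x (g i)) \<epsilon>)"
      using assms(4) by (simp flip: img)
  qed simp
  also have "\<dots> = infsum (\<lambda>j. ennreal (exp (- s * real (n j)))) J"
    using infsum_reindex[OF inj, of "\<lambda>j. ennreal (exp (- s * real (n j)))"] unfolding img o_def by (rule sym)
  finally show ?thesis .
qed

lemma bowen_premeasure_cover:
  assumes "bowen_premeasure X T s N \<epsilon> Z < c"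
  obtains I :: "nat set" and n x where "\<And>i. i \<in> I \<Longrightarrow> x i \<in> X" "\<And>i. i \<in> I \<Longrightarrow> n i \<ge> N"
    "Z \<subseteq> (\<Union>i\<in>I. bowen_ball X T (n i) (x i) \<epsilon>)"
    "infsum (\<lambda>i. ennreal (exp (- s * real (n i)))) I < c"
  proof -
  from assms obtain v where v: "v < c" "v \<in> {(\<Sum>\<^sub>\<infinity>i\<in>I. ennreal (exp (- s * real (n i)))) | (I :: nat set) n x.
            (\<forall>i\<in>I. x i \<in> X \<and> n i \<ge> N) \<and> Z \<subseteq> (\<Union>i\<in>I. bowen_ball X T (n i) (x i) \<epsilon>)}"
    unfolding bowen_premeasure_def Inf_less_iff by blast
  from v(2) obtain I :: "nat set" and n x where "v = (\<Sum>\<^sub>\<infinity>i\<in>I. ennreal (exp (- s * real (n i))))"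
    "\<forall>i\<in>I. x i \<in> X \<and> n i \<ge> N" "Z \<subseteq> (\<Union>i\<in>I. bowen_ball X T (n i) (x i) \<epsilon>)"
    by blast
  then show thesis using that[of I x n] v(1) by blast
qed

lemma bowen_premeasure_mono:
  assumes "N' \<le> N" "\<epsilon> \<le> \<epsilon>'" "s \<le> s'" "Z' \<subseteq> Z"
  shows "bowen_premeasure X T s' N' \<epsilon>' Z' \<le> bowen_premeasure X T s N \<epsilon> Z"
proof (rule dense_ge)
  fix c assume "bowen_premeasure X T s N \<epsilon> Z < c"
  then obtain I n x where I: "\<And>i. i \<in> I \<Longrightarrow> x i \<in> X" "\<And>i::nat. i \<in> I \<Longrightarrow> n i \<ge> N"
    "Z \<subseteq> (\<Union>i\<in>I. bowen_ball X T (n i) (x i) \<epsilon>)"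
    "infsum (\<lambda>i. ennreal (exp (- s * real (n i)))) I < c"
    by (rule bowen_premeasure_cover) blast
  have "Z' \<subseteq> (\<Union>i\<in>I. bowen_ball X T (n i) (x i) \<epsilon>')"
    by (intro order_trans[OF assms(4)] order_trans[OF I(3)] UN_mono order_refl bowen_ball_mono[OF assms(2)])
  then have "bowen_premeasure X T s' N' \<epsilon>' Z' \<le> infsum (\<lambda>i. ennreal (exp (- s' * real (n i)))) I"
    using I(1,2) assms(1) by (intro bowen_premeasure_le) (auto intro: order_trans)
  also have "\<dots> \<le> infsum (\<lambda>i. ennreal (exp (- s * real (n i)))) I"
    using assms(3) by (intro infsum_ennreal_mono ennreal_leI) (simp add: mult_right_mono)
  also have "\<dots> \<le> c" using I(4) by simp
  finally show "bowen_premeasure X T s' N' \<epsilon>' Z' \<le> c" .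
qed

lemma bowen_measure_eq_SUP:
  "bowen_measure X T s Z = (SUP \<epsilon>\<in>{0<..}. SUP N. bowen_premeasure X T s N \<epsilon> Z)"
proof -
  have *: "bowen_measure_eps X T s \<epsilon> Z = (SUP N. bowen_premeasure X T s N \<epsilon> Z)" for \<epsilon>
    unfolding bowen_measure_eps_def
    by (intro tendsto_Lim LIMSEQ_SUP) (auto simp: incseq_def intro!: bowen_premeasure_mono)
  show ?thesis
    unfolding bowen_measure_def * by (intro Lim_at_right_0_antimono SUP_mono) (auto intro!: bowen_premeasure_mono)
qed

lemma bowen_measure_eq_0_iff:
  "bowen_measure X T s Z = 0 \<longleftrightarrow> (\<forall>\<epsilon>>0. \<forall>N. bowen_premeasure X T s N \<epsilon> Z = 0)"
  unfolding bowen_measure_eq_SUP bot_ennreal[symmetric] SUP_bot_conv by auto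

text \<open>A single scale suffices for a lower bound on the entropy: the premeasure only grows when \<open>N\<close>
  grows, \<open>\<epsilon>\<close> shrinks or the exponent decreases, so positivity at one \<open>(s, N, \<epsilon>)\<close> rules out every
  exponent below \<open>s\<close>.\<close>

lemma bowen_entropy_geI:
  assumes "bowen_premeasure X T s N \<epsilon> Z > 0" "\<epsilon> > 0"
  shows "ennreal s \<le> bowen_entropy X T Z"
  unfolding bowen_entropy_def
proof (rule Inf_greatest, clarify)
  fix t :: real assume t: "t \<ge> 0" "bowen_measure X T t Z = 0"
  have "\<not> t \<le> s"
  proof
    assume "t \<le> s"
    then have "bowen_premeasure X T s N \<epsilon> Z \<le> bowen_premeasure X T t N \<epsilon> Z"
      by (intro bowen_premeasure_mono) auto
    also have "\<dots> = 0" using t assms(2) by (auto simp: bowen_measure_eq_0_iff)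
    finally show False using assms(1) by simp
  qed
  then show "ennreal s \<le> ennreal t" by (intro ennreal_leI) simp
qed

lemma less_bowen_entropyE:
  assumes "ennreal s < bowen_entropy X T Z" "s \<ge> 0"
  obtains N \<epsilon> where "\<epsilon> > 0" "N \<ge> 1" "bowen_premeasure X T s N \<epsilon> Z > 0"
proof -
  have "bowen_measure X T s Z \<noteq> 0"
  proof
    assume "bowen_measure X T s Z = 0"
    then have "bowen_entropy X T Z \<le> ennreal s"
      unfolding bowen_entropy_def using assms(2) by (intro Inf_lower) auto
    then show False using assms(1) by simp
  qed
  then obtain \<epsilon> N where e: "\<epsilon> > 0" "bowen_premeasure X T s N \<epsilon> Z > 0"
    by (auto simp: bowen_measure_eq_0_iff zero_less_iff_neq_zero)
  have "bowen_premeasure X T s N \<epsilon> Z \<le> bowen_premeasure X T s (max 1 N) \<epsilon> Z"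
    by (intro bowen_premeasure_mono) auto
  then show ?thesis using e that[of \<epsilon> "max 1 N"] by (auto intro: order_less_le_trans)
qed

lemma bowen_entropy_mono:
  assumes "Z' \<subseteq> Z"
  shows "bowen_entropy X T Z' \<le> bowen_entropy X T Z"
  unfolding bowen_entropy_def
proof (rule Inf_superset_mono, clarify)
  fix s :: real assume s: "s \<ge> 0" "bowen_measure X T s Z = 0"
  have "bowen_premeasure X T s N \<epsilon> Z' \<le> bowen_premeasure X T s N \<epsilon> Z" for N \<epsilon>
    using assms by (intro bowen_premeasure_mono) auto
  then show "\<exists>s'. ennreal s = ennreal s' \<and> s' \<ge> 0 \<and> bowen_measure X T s' Z' = 0"
    using s by (intro exI[of _ s]) (metis bowen_measure_eq_0_iff le_zero_eq)
qed

section \<open>From a finitely additive set function to a Borel measure\<close>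

lemma finitely_additive_mono:
  fixes m :: "'a set \<Rightarrow> real"
  assumes "\<And>A. 0 \<le> m A" "\<And>A B. A \<inter> B = {} \<Longrightarrow> m (A \<union> B) = m A + m B" "A \<subseteq> B"
  shows "m A \<le> m B"
proof -
  have "m (A \<union> (B - A)) = m A + m (B - A)" by (intro assms(2)) auto
  moreover have "A \<union> (B - A) = B" using assms(3) by auto
  ultimately show ?thesis using assms(1)[of "B - A"] by simp
qed

text \<open>A substitute for weak-* limits of measures. A finitely additive probability \<open>m\<close> on all subsets
  is turned into a Borel measure as in the proof of the Riesz representation theorem: the inner
  content \<open>l U\<close> of an open set is the supremum of \<open>m\<close> over its compact subsets, and \<open>f\<close> is the outer
  measure induced by \<open>l\<close>. Compactness makes \<open>l\<close> countably subadditive although \<open>m\<close> is only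
  finitely additive, and Caratheodory's theorem applies because \<open>m\<close> adds up over
  disjoint compact subsets. On open sets the measure does not exceed \<open>m\<close>, as for weak-* limits; no
  mass is lost, because \<open>K\<close> is compact.\<close>

lemma borel_measure_below_finitely_additive:
  fixes m :: "'a::metric_space set \<Rightarrow> real"
  assumes nonneg: "\<And>A. 0 \<le> m A"
    and additive: "\<And>A B. A \<inter> B = {} \<Longrightarrow> m (A \<union> B) = m A + m B"
    and K: "compact K" "m K = 1" "m (- K) = 0"
  obtains \<mu> :: "'a measure" where "prob_space \<mu>" "sets \<mu> = sets borel" "emeasure \<mu> K = 1"
    "\<And>U. open U \<Longrightarrow> emeasure \<mu> U \<le> ennreal (m U)"
proof -
  have m_mono: "m A \<le> m B" if "A \<subseteq> B" for A B
    using nonneg additive that by (rule finitely_additive_mono)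
  have m_empty: "m {} = 0" using additive[of "{}" "{}"] by simp
  have m_Un: "m (A \<union> B) \<le> m A + m B" for A B
  proof -
    have "m (A \<union> (B - A)) = m A + m (B - A)" by (intro additive) auto
    moreover have "A \<union> (B - A) = A \<union> B" by auto
    ultimately show ?thesis using m_mono[of "B - A" B] by auto
  qed
  have m_UN: "m (\<Union>i\<in>I. A i) \<le> (\<Sum>i\<in>I. m (A i))" if "finite I" for I :: "nat set" and A
    using that
  proof induction
    case (insert i I)
    show ?case using m_Un[of "A i" "\<Union>i\<in>I. A i"] insert by simp
  qed (simp add: m_empty)

  define l where "l U = (SUP F\<in>{F. compact F \<and> F \<subseteq> U}. ennreal (m F))" for U
  define f where "f A = (INF U\<in>{U. open U \<and> A \<subseteq> U}. l U)" for A
  have l_ge: "ennreal (m F) \<le> l U" if "compact F" "F \<subseteq> U" for F U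
    unfolding l_def using that by (intro SUP_upper) auto
  have l_le: "l U \<le> ennreal (m U)" for U
    unfolding l_def by (intro SUP_least ennreal_leI m_mono) auto
  have l_mono: "l U \<le> l V" if "U \<subseteq> V" for U V
    unfolding l_def using that by (intro SUP_subset_mono) auto
  have f_le: "f A \<le> l U" if "open U" "A \<subseteq> U" for A U
    unfolding f_def using that by (intro INF_lower) auto
  have f_open: "f U = l U" if "open U" for U
    by (intro antisym f_le that) (auto simp: f_def intro!: INF_greatest l_mono)
  have f_mono: "f A \<le> f B" if "A \<subseteq> B" for A B
    unfolding f_def using that by (intro INF_superset_mono) auto

  \<comment> \<open>A compact subset of a union is split into compact pieces, one inside each of finitely many members.\<close>
  have l_UN: "l (\<Union>i. U i) \<le> (\<Sum>i. l (U i))" if op: "\<And>i. open (U i)" for U :: "nat \<Rightarrow> 'a set"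
    unfolding l_def[of "\<Union>i. U i"]
  proof (rule SUP_least, clarify)
    fix F assume F: "compact F" "F \<subseteq> (\<Union>i. U i)"
    have "\<exists>i r. 0 < r \<and> cball x r \<subseteq> U i" if "x \<in> F" for x
    proof -
      obtain i where "x \<in> U i" using F(2) \<open>x \<in> F\<close> by auto
      then show ?thesis using op[of i] unfolding open_contains_cball by blast
    qed
    then obtain i r where ir: "\<And>x. x \<in> F \<Longrightarrow> 0 < r x \<and> cball x (r x) \<subseteq> U (i x)" by metis
    have "F \<subseteq> (\<Union>x\<in>F. ball x (r x))" using ir by force
    then obtain D where D: "D \<subseteq> F" "finite D" "F \<subseteq> (\<Union>x\<in>D. ball x (r x))"
      by (rule compactE_image[OF F(1) open_ball]) auto
    define G where "G j = F \<inter> (\<Union>x\<in>{x\<in>D. i x = j}. cball x (r x))" for j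
    have G: "compact (G j)" "G j \<subseteq> U j" for j
      using D F(1) ir unfolding G_def by (auto intro!: compact_Int_closed closed_UN)
    have "F \<subseteq> (\<Union>j\<in>i ` D. G j)" using D(3) by (fastforce simp: G_def)
    then have "m F \<le> m (\<Union>j\<in>i ` D. G j)" by (rule m_mono)
    also have "\<dots> \<le> (\<Sum>j\<in>i ` D. m (G j))" using D(2) by (intro m_UN finite_imageI)
    finally have "m F \<le> (\<Sum>j\<in>i ` D. m (G j))" .
    then have "ennreal (m F) \<le> (\<Sum>j\<in>i ` D. ennreal (m (G j)))"
      using sum_ennreal[of "i ` D" "\<lambda>j. m (G j)"] nonneg by (simp add: ennreal_leI)
    also have "\<dots> \<le> (\<Sum>j\<in>i ` D. l (U j))" by (intro sum_mono l_ge G)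
    also have "\<dots> \<le> (\<Sum>j. l (U j))" using D(2) by (intro sum_le_suminf) auto
    finally show "ennreal (m F) \<le> (\<Sum>j. l (U j))" .
  qed

  have f_UN: "f (\<Union>i. A i) \<le> (\<Sum>i. f (A i))" for A :: "nat \<Rightarrow> 'a set"
  proof (rule ennreal_le_epsilon)
    fix e :: real assume e: "0 < e" and fin: "(\<Sum>i. f (A i)) < top"
    have "\<exists>U. open U \<and> A i \<subseteq> U \<and> l U < f (A i) + ennreal (e * (1/2) ^ Suc i)" for i
    proof -
      have "f (A i) < top" using fin by (metis ennreal_suminf_lessD)
      then have "f (A i) < f (A i) + ennreal (e * (1/2) ^ Suc i)"
        using e ennreal_add_left_cancel_less[of "f (A i)" 0 "ennreal (e * (1/2) ^ Suc i)"] by simp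
      then have "\<exists>U\<in>{U. open U \<and> A i \<subseteq> U}. l U < f (A i) + ennreal (e * (1/2) ^ Suc i)"
        unfolding INF_less_iff[symmetric] f_def[of "A i", symmetric] .
      then show ?thesis by blast
    qed
    then obtain U where U: "\<And>i. open (U i)" "\<And>i. A i \<subseteq> U i"
      "\<And>i. l (U i) < f (A i) + ennreal (e * (1/2) ^ Suc i)" by metis
    have "f (\<Union>i. A i) \<le> l (\<Union>i. U i)" using U by (intro f_le) auto
    also have "\<dots> \<le> (\<Sum>i. l (U i))" by (intro l_UN U)
    also have "\<dots> \<le> (\<Sum>i. f (A i) + ennreal (e * (1/2) ^ Suc i))"
      using U(3) by (intro suminf_le) (auto intro: less_imp_le)
    also have "\<dots> = (\<Sum>i. f (A i)) + (\<Sum>i. ennreal (e * (1/2) ^ Suc i))"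
      by (intro suminf_add[symmetric]) auto
    also have "(\<Sum>i. ennreal (e * (1/2) ^ Suc i)) = ennreal e"
      using e by (intro suminf_ennreal_half_powers) simp
    finally show "f (\<Union>i. A i) \<le> (\<Sum>i. f (A i)) + ennreal e" .
  qed

  have oms: "outer_measure_space (Pow UNIV) f"
    using f_open[of "{}"] l_le[of "{}"] f_mono f_UN
    by (simp add: outer_measure_space_def positive_def increasing_def countably_subadditive_def m_empty)
  have f_Un: "f (A \<union> B) \<le> f A + f B" for A B
  proof -
    have "f (\<Union>i. binaryset A B i) \<le> (\<Sum>i. f (binaryset A B i))" by (rule f_UN)
    also have "\<dots> = f A + f B"
      using f_open[of "{}"] l_le[of "{}"] by (intro suminf_binaryset_eq) (auto simp: m_empty)
    finally show ?thesis by (simp add: UN_binaryset_eq)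
  qed

  \<comment> \<open>Exhaust \<open>U \<inter> V\<close> by a compact \<open>F\<close>, and then the open set \<open>U - F\<close>, which contains \<open>A - V\<close>, by a
    compact \<open>G\<close>; both lie in \<open>U\<close> and are disjoint.\<close>
  have measurable: "V \<in> lambda_system UNIV (Pow UNIV) f" if V: "open V" for V
  proof -
    have "f (V \<inter> A) + f ((UNIV - V) \<inter> A) = f A" for A
    proof (rule antisym)
      show "f (V \<inter> A) + f ((UNIV - V) \<inter> A) \<le> f A"
        unfolding f_def[of A]
      proof (rule INF_greatest, clarify)
        fix U assume U: "open U" "A \<subseteq> U"
        have "f (V \<inter> A) + f ((UNIV - V) \<inter> A) \<le> l (U \<inter> V) + f ((UNIV - V) \<inter> A)"
          using U V by (intro add_right_mono f_le) auto
        also have "\<dots> = (SUP F\<in>{F. compact F \<and> F \<subseteq> U \<inter> V}. ennreal (m F) + f ((UNIV - V) \<inter> A))"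
          unfolding l_def by (intro ennreal_SUP_add_left[symmetric]) auto
        also have "\<dots> \<le> l U"
        proof (rule SUP_least, clarify)
          fix F assume F: "compact F" "F \<subseteq> U \<inter> V"
          have "ennreal (m F) + f ((UNIV - V) \<inter> A) \<le> ennreal (m F) + l (U - F)"
            using U F by (intro add_left_mono f_le) (auto simp: compact_imp_closed open_Diff)
          also have "\<dots> = (SUP G\<in>{G. compact G \<and> G \<subseteq> U - F}. ennreal (m F) + ennreal (m G))"
            unfolding l_def by (intro ennreal_SUP_add_right) auto
          also have "\<dots> \<le> l U"
          proof (rule SUP_least, clarify)
            fix G assume G: "compact G" "G \<subseteq> U - F"
            have "m (F \<union> G) = m F + m G" using G by (intro additive) auto
            then have "ennreal (m F) + ennreal (m G) = ennreal (m (F \<union> G))"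
              by (simp add: nonneg)
            also have "\<dots> \<le> l U" using F G by (intro l_ge compact_Un) auto
            finally show "ennreal (m F) + ennreal (m G) \<le> l U" .
          qed
          finally show "ennreal (m F) + f ((UNIV - V) \<inter> A) \<le> l U" .
        qed
        finally show "f (V \<inter> A) + f ((UNIV - V) \<inter> A) \<le> l U" .
      qed
      have "A = (V \<inter> A) \<union> ((UNIV - V) \<inter> A)" by auto
      then show "f A \<le> f (V \<inter> A) + f ((UNIV - V) \<inter> A)" using f_Un[of "V \<inter> A" "(UNIV - V) \<inter> A"] by simp
    qed
    then show ?thesis by (simp add: lambda_system_def)
  qed

  let ?L = "lambda_system UNIV (Pow UNIV) f"
  have ms: "measure_space UNIV ?L f"
    by (rule sigma_algebra.caratheodory_lemma[OF sigma_algebra_Pow oms])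
  have sub: "sets borel \<subseteq> ?L"
  proof -
    have "sigma_sets UNIV (Collect open) \<subseteq> ?L"
      using ms measurable by (intro sigma_algebra.sigma_sets_subset) (auto simp: measure_space_def)
    then show ?thesis by (simp add: borel_def)
  qed
  have ms': "measure_space UNIV (sets borel) f"
    using ms sub sets.sigma_algebra_axioms[of borel] by (intro measure_down[OF ms]) auto
  define \<mu> where "\<mu> = measure_of UNIV (sets borel) f"
  have sets: "sets \<mu> = sets borel"
    unfolding \<mu>_def using sets.sigma_sets_eq[of borel] by (simp add: sets_measure_of)
  have em: "emeasure \<mu> A = f A" if "A \<in> sets borel" for A
    using that ms' sets.sigma_algebra_axioms[of borel] unfolding \<mu>_def measure_space_def
    by (intro emeasure_measure_of_sigma) auto
  have open_le: "emeasure \<mu> U \<le> ennreal (m U)" if "open U" for U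
    using that em[of U] f_open l_le by simp
  have "m UNIV = 1" using additive[of K "- K"] K by (simp add: Compl_partition)
  then have up: "emeasure \<mu> UNIV \<le> 1" using open_le[of UNIV] by simp
  have "1 \<le> f K" unfolding f_def using l_ge[OF K(1)] K(2) by (auto intro!: INF_greatest)
  moreover have "emeasure \<mu> K = f K" using K(1) by (intro em borel_closed compact_imp_closed)
  moreover have "emeasure \<mu> K \<le> emeasure \<mu> UNIV"
    by (intro emeasure_mono) (auto simp: sets)
  ultimately have "emeasure \<mu> K = 1" "emeasure \<mu> UNIV = 1" using up by auto
  moreover have "space \<mu> = UNIV" using sets_eq_imp_space_eq[OF sets] by simp
  ultimately show ?thesis by (intro that[of \<mu>] prob_spaceI sets open_le) auto
qed

text \<open>The set functions are bounded by 1 and defined on every subset of the type, so that they form a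
  closed subset of a product of compact intervals, to which Tychonoff's theorem applies.\<close>

definition finitely_additive_probs :: "'a set \<Rightarrow> ('a set \<Rightarrow> real) set" where
  "finitely_additive_probs K = {m. (\<forall>A. 0 \<le> m A \<and> m A \<le> 1) \<and>
     (\<forall>A B. A \<inter> B = {} \<longrightarrow> m (A \<union> B) = m A + m B) \<and> m K = 1 \<and> m (- K) = 0}"

lemma compact_PiE_UNIV:
  assumes "\<And>i. compact (S i)"
  shows "compact {x :: 'i \<Rightarrow> 'b::topological_space. \<forall>i. x i \<in> S i}"
proof -
  have "compactin (product_topology (\<lambda>i. euclidean) UNIV) (PiE UNIV S)"
    using assms by (simp add: compactin_PiE)
  moreover have "PiE UNIV S = {x. \<forall>i. x i \<in> S i}" by (auto simp: PiE_def)
  ultimately show ?thesis by (simp add: euclidean_product_topology)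
qed

lemma closed_eval_le:
  "closed {m :: 'i \<Rightarrow> real. m A \<le> c}"
  by (intro closed_Collect_le continuous_on_product_coordinates continuous_on_const)

lemma compact_finitely_additive_probs: "compact (finitely_additive_probs K)"
proof -
  have "closed {m :: 'a set \<Rightarrow> real. A \<inter> B = {} \<longrightarrow> m (A \<union> B) = m A + m B}" for A B
    by (cases "A \<inter> B = {}")
      (auto intro!: closed_Collect_eq continuous_on_product_coordinates continuous_on_add)
  then have "closed {m :: 'a set \<Rightarrow> real. (\<forall>A B. A \<inter> B = {} \<longrightarrow> m (A \<union> B) = m A + m B) \<and> m K = 1 \<and> m (- K) = 0}"
    by (intro closed_Collect_conj closed_Collect_all closed_Collect_eq
        continuous_on_product_coordinates continuous_on_const)
  from compact_Int_closed[OF compact_PiE_UNIV[of "\<lambda>_. {0..1::real}"] this] show ?thesis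
    unfolding finitely_additive_probs_def by (simp add: Collect_conj_eq)
qed

text \<open>Upper bounds on the values at given sets are closed conditions, so it suffices to satisfy finitely
  many of them at a time.\<close>

lemma finitely_additive_probs_fip:
  assumes "\<And>F. finite F \<Longrightarrow> F \<subseteq> C \<Longrightarrow> \<exists>m\<in>finitely_additive_probs K. \<forall>i\<in>F. m (B i) \<le> r i"
  shows "\<exists>m\<in>finitely_additive_probs K. \<forall>i\<in>C. m (B i) \<le> r i"
proof -
  have "finitely_additive_probs K \<inter> (\<Inter>i\<in>C. {m. m (B i) \<le> r i}) \<noteq> {}"
  proof (rule compact_imp_fip_image[OF compact_finitely_additive_probs])
    fix I' assume "finite I'" "I' \<subseteq> C"
    from assms[OF this] show "finitely_additive_probs K \<inter> (\<Inter>i\<in>I'. {m. m (B i) \<le> r i}) \<noteq> {}"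
      by blast
  qed (rule closed_eval_le)
  then show ?thesis by blast
qed

section \<open>A Frostman lemma for Bowen balls\<close>

text \<open>Mass is added to one point after another, each time as much as the bounds \<open>r\<close> allow. Afterwards
  every point lies in a set whose bound is attained.\<close>

lemma saturated_weights:
  fixes B :: "'i \<Rightarrow> 'a set" and r :: "'i \<Rightarrow> real"
  assumes "finite P" "finite F" "\<And>i. i \<in> F \<Longrightarrow> 0 \<le> r i" "\<And>x. x \<in> P \<Longrightarrow> \<exists>i\<in>F. x \<in> B i"
  shows "\<exists>w. (\<forall>x. 0 \<le> w x) \<and> (\<forall>i\<in>F. sum w (P \<inter> B i) \<le> r i) \<and>
    (\<forall>x\<in>P. \<exists>i\<in>F. x \<in> B i \<and> sum w (P \<inter> B i) = r i)"
  using assms(1,4)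
proof (induction P)
  case empty
  then show ?case using assms(3) by (intro exI[of _ "\<lambda>_. 0"]) auto
next
  case (insert x P)
  then obtain w where w: "\<And>y. 0 \<le> w y" "\<And>i. i \<in> F \<Longrightarrow> sum w (P \<inter> B i) \<le> r i"
    "\<And>y. y \<in> P \<Longrightarrow> \<exists>i\<in>F. y \<in> B i \<and> sum w (P \<inter> B i) = r i"
    using insert.IH insert.prems by (metis insertCI)
  define R where "R = (\<lambda>i. r i - sum w (P \<inter> B i)) ` {i\<in>F. x \<in> B i}"
  have R: "finite R" "R \<noteq> {}" using assms(2) insert.prems unfolding R_def by auto
  define v where "v = w(x := Min R)"
  have v0: "0 \<le> v y" for y
    using w(1) R w(2) by (auto simp: v_def R_def)
  have v_sum: "sum v (insert x P \<inter> B i) = sum w (P \<inter> B i) + (if x \<in> B i then Min R else 0)" for i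
  proof -
    have "sum v (P \<inter> B i) = sum w (P \<inter> B i)"
      using insert.hyps by (intro sum.cong) (auto simp: v_def)
    then show ?thesis using insert.hyps by (auto simp: Int_insert_left v_def)
  qed
  have v_le: "sum v (insert x P \<inter> B i) \<le> r i" if "i \<in> F" for i
  proof (cases "x \<in> B i")
    case True
    then have "Min R \<le> r i - sum w (P \<inter> B i)" using that R by (intro Min_le) (auto simp: R_def)
    then show ?thesis unfolding v_sum using True by simp
  next
    case False
    then show ?thesis unfolding v_sum using that w(2) by simp
  qed
  have "\<exists>i\<in>F. y \<in> B i \<and> sum v (insert x P \<inter> B i) = r i" if y: "y \<in> insert x P" for y
  proof (cases "y = x")
    case True
    have "Min R \<in> R" using R by simp
    then obtain i where "i \<in> F" "x \<in> B i" "Min R = r i - sum w (P \<inter> B i)" by (auto simp: R_def)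
    then show ?thesis unfolding v_sum using True by (intro bexI[of _ i]) auto
  next
    case False
    then obtain i where i: "i \<in> F" "y \<in> B i" "sum w (P \<inter> B i) = r i" using w(3) y by auto
    \<comment> \<open>A ball that was saturated stays so: adding mass can only increase its total.\<close>
    have "sum w (P \<inter> B i) \<le> sum v (insert x P \<inter> B i)"
      unfolding v_sum using v0[of x] by (simp add: v_def)
    then show ?thesis using i v_le[of i] by force
  qed
  then show ?case using v0 v_le by blast
qed

text \<open>Select balls greedily in the order of increasing time, keeping those that are disjoint from the
  earlier choices. A rejected ball meets a chosen one of smaller or equal time, which engulfs it after
  tripling the radius.\<close>

lemma vitali_bowen_balls:
  assumes "finite F" "\<And>p. p \<in> F \<Longrightarrow> 1 \<le> fst p \<and> snd p \<in> X" "\<epsilon> > 0"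
  obtains D where "D \<subseteq> F"
    "disjoint_family_on (\<lambda>(n, x). bowen_ball X T n x \<epsilon>) D"
    "(\<Union>(n, x)\<in>F. bowen_ball X T n x \<epsilon>) \<subseteq> (\<Union>(n, x)\<in>D. bowen_ball X T n x (3 * \<epsilon>))"
proof -
  let ?B = "\<lambda>p. bowen_ball X T (fst p) (snd p) \<epsilon>"
  have "\<exists>D\<subseteq>F. disjoint_family_on ?B D \<and> (\<forall>p\<in>F. \<exists>q\<in>D. fst q \<le> fst p \<and> ?B q \<inter> ?B p \<noteq> {})"
    using assms(1,2)
  proof (induction F rule: finite_ranking_induct[where f = fst])
    case empty
    then show ?case by (auto simp: disjoint_family_on_def)
  next
    case (insert p F)
    have "\<exists>D\<subseteq>F. disjoint_family_on ?B D \<and> (\<forall>p\<in>F. \<exists>q\<in>D. fst q \<le> fst p \<and> ?B q \<inter> ?B p \<noteq> {})"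
      by (rule insert.IH) (use insert.prems in auto)
    then obtain D where D: "D \<subseteq> F" "disjoint_family_on ?B D"
      "\<And>p. p \<in> F \<Longrightarrow> \<exists>q\<in>D. fst q \<le> fst p \<and> ?B q \<inter> ?B p \<noteq> {}"
      by blast
    show ?case
    proof (cases "\<exists>q\<in>D. ?B q \<inter> ?B p \<noteq> {}")
      case True
      then have "\<forall>p'\<in>insert p F. \<exists>q\<in>D. fst q \<le> fst p' \<and> ?B q \<inter> ?B p' \<noteq> {}"
        using D insert.hyps(2) by blast
      then show ?thesis using D by blast
    next
      case False
      have "snd p \<in> ?B p" using insert.prems[of p] assms(3) by (intro centre_in_bowen_ball) auto
      then have "\<forall>p'\<in>insert p F. \<exists>q\<in>insert p D. fst q \<le> fst p' \<and> ?B q \<inter> ?B p' \<noteq> {}"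
        using D(3) by blast
      moreover have "disjoint_family_on ?B (insert p D)"
        using False D(2) unfolding disjoint_family_on_def by blast
      ultimately show ?thesis using D(1) by blast
    qed
  qed
  then obtain D where D: "D \<subseteq> F" "disjoint_family_on ?B D"
    "\<And>p. p \<in> F \<Longrightarrow> \<exists>q\<in>D. fst q \<le> fst p \<and> ?B q \<inter> ?B p \<noteq> {}"
    by blast
  have "?B p \<subseteq> (\<Union>(n, x)\<in>D. bowen_ball X T n x (3 * \<epsilon>))" if p: "p \<in> F" for p
  proof -
    obtain q where q: "q \<in> D" "fst q \<le> fst p" "?B q \<inter> ?B p \<noteq> {}" using D(3) p by blast
    then have "?B p \<subseteq> bowen_ball X T (fst q) (snd q) (3 * \<epsilon>)"
      using assms(2)[of q] D(1) by (intro bowen_ball_engulf) auto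
    then show ?thesis using q(1) by (auto simp: case_prod_beta)
  qed
  then show ?thesis using D by (intro that[of D]) (auto simp: case_prod_beta')
qed

text \<open>Distribute mass greedily over finitely many points of \<open>K\<close>, with bound \<open>exp (- s n)\<close> on every ball
  of the family and bound \<open>c\<close> on the total. If the total stayed below \<open>c\<close>, then \<open>K\<close> would be covered
  by balls whose bound is attained. By the Vitali lemma, disjoint ones among them cover \<open>K\<close> after
  tripling the radius, so their bounds add up to at least the premeasure of \<open>K\<close>; but these bounds
  are masses of disjoint sets, so the total would be at least \<open>c\<close> after all. Division by \<open>c\<close> gives a
  probability.\<close>

lemma finite_frostman:
  fixes X :: "'a::metric_space set"
  assumes K: "K \<subseteq> X" and "\<epsilon> > 0" and c: "0 < c" "ennreal c \<le> bowen_premeasure X T s N (3 * \<epsilon>) K"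
    and F: "finite F" "\<And>p. p \<in> F \<Longrightarrow> 1 \<le> fst p \<and> N \<le> fst p \<and> snd p \<in> X"
  shows "\<exists>m\<in>finitely_additive_probs K. \<forall>p\<in>F.
    m (bowen_ball X T (fst p) (snd p) \<epsilon>) \<le> exp (- s * real (fst p)) / c"
proof -
  \<comment> \<open>The index \<open>None\<close> stands for the bound on the total mass.\<close>
  define B where "B q = (case q of None \<Rightarrow> UNIV | Some p \<Rightarrow> bowen_ball X T (fst p) (snd p) \<epsilon>)" for q
  define r where "r q = (case q of None \<Rightarrow> c | Some p \<Rightarrow> exp (- s * real (fst p)))" for q :: "(nat \<times> 'a) option"
  let ?h = "\<lambda>x. {p\<in>F. x \<in> B (Some p)}"
  \<comment> \<open>One point of \<open>K\<close> for each pattern of membership in the balls.\<close>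
  have "finite (?h ` K)" by (rule finite_subset[of _ "Pow F"]) (use F(1) in auto)
  then obtain P where P: "P \<subseteq> K" "finite P" "?h ` K = ?h ` P"
    using finite_subset_image[OF _ order_refl, of ?h K] by blast
  let ?F = "insert None (Some ` F)"
  have "\<exists>w. (\<forall>x. 0 \<le> w x) \<and> (\<forall>q\<in>?F. sum w (P \<inter> B q) \<le> r q) \<and>
      (\<forall>x\<in>P. \<exists>q\<in>?F. x \<in> B q \<and> sum w (P \<inter> B q) = r q)"
  proof (rule saturated_weights)
    show "0 \<le> r q" for q using c(1) by (simp add: r_def split: option.split)
    show "\<exists>q\<in>?F. x \<in> B q" for x by (rule bexI[of _ None]) (simp_all add: B_def)
  qed (use P(2) F(1) in auto)
  then obtain w where w: "\<And>x. 0 \<le> w x" "\<And>q. q \<in> ?F \<Longrightarrow> sum w (P \<inter> B q) \<le> r q"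
    "\<And>x. x \<in> P \<Longrightarrow> \<exists>q\<in>?F. x \<in> B q \<and> sum w (P \<inter> B q) = r q"
    by metis
  have total: "sum w P = c"
  proof (rule antisym)
    show "sum w P \<le> c" using w(2)[of None] by (simp add: B_def r_def)
    show "c \<le> sum w P"
    proof (rule ccontr)
      assume "\<not> c \<le> sum w P"
      define S where "S = {p\<in>F. sum w (P \<inter> B (Some p)) = exp (- s * real (fst p))}"
      have cov: "K \<subseteq> (\<Union>(n, x)\<in>S. bowen_ball X T n x \<epsilon>)"
      proof
        fix y assume "y \<in> K"
        then obtain x where x: "x \<in> P" "?h y = ?h x" using P(3) by blast
        obtain q where q: "q \<in> ?F" "x \<in> B q" "sum w (P \<inter> B q) = r q"
          using w(3)[OF x(1)] by blast
        with \<open>\<not> c \<le> sum w P\<close> obtain p where p: "q = Some p" "p \<in> F" by (auto simp: B_def r_def)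
        then have "p \<in> S" "y \<in> B (Some p)" using q x(2) by (auto simp: S_def r_def)
        then show "y \<in> (\<Union>(n, x)\<in>S. bowen_ball X T n x \<epsilon>)" by (auto simp: B_def case_prod_beta)
      qed
      have S: "finite S" "\<And>p. p \<in> S \<Longrightarrow> 1 \<le> fst p \<and> snd p \<in> X" using F by (auto simp: S_def)
      obtain D where D: "D \<subseteq> S" "disjoint_family_on (\<lambda>(n, x). bowen_ball X T n x \<epsilon>) D"
        "(\<Union>(n, x)\<in>S. bowen_ball X T n x \<epsilon>) \<subseteq> (\<Union>(n, x)\<in>D. bowen_ball X T n x (3 * \<epsilon>))"
        by (rule vitali_bowen_balls[OF S \<open>\<epsilon> > 0\<close>])
      have fD: "finite D" using D(1) S(1) by (rule finite_subset)
      have "ennreal c \<le> bowen_premeasure X T s N (3 * \<epsilon>) K" by (rule c)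
      also have "\<dots> \<le> infsum (\<lambda>p. ennreal (exp (- s * real (fst p)))) D"
        using D S F cov fD
        by (intro bowen_premeasure_le[where x = snd]) (auto simp: case_prod_beta countable_finite S_def)
      also have "\<dots> = ennreal (\<Sum>p\<in>D. exp (- s * real (fst p)))" using fD by simp
      also have "(\<Sum>p\<in>D. exp (- s * real (fst p))) = (\<Sum>p\<in>D. sum w (P \<inter> B (Some p)))"
        using D(1) by (intro sum.cong) (auto simp: S_def)
      also have "\<dots> = sum w (\<Union>p\<in>D. P \<inter> B (Some p))"
      proof (rule sum.UNION_disjoint[symmetric])
        show "\<forall>p\<in>D. \<forall>q\<in>D. p \<noteq> q \<longrightarrow> (P \<inter> B (Some p)) \<inter> (P \<inter> B (Some q)) = {}"
          using D(2) by (fastforce simp: disjoint_family_on_def B_def case_prod_beta)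
      qed (use fD P(2) in auto)
      also have "ennreal \<dots> \<le> ennreal (sum w P)"
        using P(2) w(1) by (intro ennreal_leI sum_mono2) auto
      finally show False
        using \<open>\<not> c \<le> sum w P\<close> w(1) by (simp add: sum_nonneg)
    qed
  qed
  define m where "m A = sum w (P \<inter> A) / c" for A
  have "m A \<le> 1" for A
  proof -
    have "sum w (P \<inter> A) \<le> sum w P" using P(2) w(1) by (intro sum_mono2) auto
    then show ?thesis using total c(1) by (simp add: m_def)
  qed
  moreover have "m (A \<union> A') = m A + m A'" if "A \<inter> A' = {}" for A A'
  proof -
    have "sum w (P \<inter> (A \<union> A')) = sum w (P \<inter> A) + sum w (P \<inter> A')"
      unfolding Int_Un_distrib using P(2) that by (intro sum.union_disjoint) auto
    then show ?thesis by (simp add: m_def add_divide_distrib)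
  qed
  moreover have "0 \<le> m A" for A using w(1) c(1) by (simp add: m_def sum_nonneg)
  moreover have "m K = 1" "m (- K) = 0"
  proof -
    have "P \<inter> K = P" "P \<inter> - K = {}" using P(1) by auto
    then show "m K = 1" "m (- K) = 0" using total c(1) by (auto simp: m_def)
  qed
  ultimately have "m \<in> finitely_additive_probs K" by (simp add: finitely_additive_probs_def)
  moreover have "m (bowen_ball X T (fst p) (snd p) \<epsilon>) \<le> exp (- s * real (fst p)) / c" if "p \<in> F" for p
    using w(2)[of "Some p"] that c(1) by (auto simp: m_def B_def r_def divide_right_mono)
  ultimately show ?thesis by blast
qed

text \<open>All Bowen balls are treated at once by compactness, and the resulting finitely additive
  probability is replaced by a Borel measure, which is no larger on the balls because these are open
  relative to \<open>X\<close>.\<close>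

lemma frostman:
  fixes X :: "'a::metric_space set"
  assumes X: "tds X T" and K: "compact K" "K \<subseteq> X" and "\<epsilon> > 0" "N \<ge> 1"
    and c: "0 < c" "ennreal c \<le> bowen_premeasure X T s N (3 * \<epsilon>) K"
  obtains \<mu> where "\<mu> \<in> borel_prob_measures X" "measure \<mu> K = 1"
    "\<And>n x. n \<ge> N \<Longrightarrow> x \<in> X \<Longrightarrow> measure \<mu> (bowen_ball X T n x \<epsilon>) \<le> exp (- s * real n) / c"
proof -
  have "\<exists>m\<in>finitely_additive_probs K. \<forall>p\<in>{p. N \<le> fst p \<and> snd p \<in> X}.
    m (bowen_ball X T (fst p) (snd p) \<epsilon>) \<le> exp (- s * real (fst p)) / c"
  proof (rule finitely_additive_probs_fip)
    fix F assume "finite F" "F \<subseteq> {p. N \<le> fst p \<and> snd p \<in> X}"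
    then show "\<exists>m\<in>finitely_additive_probs K. \<forall>p\<in>F.
        m (bowen_ball X T (fst p) (snd p) \<epsilon>) \<le> exp (- s * real (fst p)) / c"
      using \<open>N \<ge> 1\<close> by (intro finite_frostman[OF K(2) \<open>\<epsilon> > 0\<close> c]) (auto intro: order_trans)
  qed
  then obtain m where m: "m \<in> finitely_additive_probs K"
    "\<And>n x. n \<ge> N \<Longrightarrow> x \<in> X \<Longrightarrow> m (bowen_ball X T n x \<epsilon>) \<le> exp (- s * real n) / c"
    by fastforce
  have m': "0 \<le> m A" "A \<inter> A' = {} \<Longrightarrow> m (A \<union> A') = m A + m A'" "m K = 1" "m (- K) = 0" for A A'
    using m(1) by (auto simp: finitely_additive_probs_def)
  obtain \<nu> where \<nu>: "prob_space \<nu>" "sets \<nu> = sets borel" "emeasure \<nu> K = 1"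
    "\<And>U. open U \<Longrightarrow> emeasure \<nu> U \<le> ennreal (m U)"
    using borel_measure_below_finitely_additive[OF m'(1,2) K(1) m'(3,4)] by metis
  interpret \<nu>: prob_space \<nu> by (rule \<nu>(1))
  have closed: "closed X" "closed K" using X K by (auto simp: tds_def compact_imp_closed)
  have sp: "space \<nu> = UNIV" using sets_eq_imp_space_eq[OF \<nu>(2)] by simp
  have sets: "X \<in> sets \<nu>" "K \<in> sets \<nu>" using closed by (auto simp: \<nu>(2))
  define \<mu> where "\<mu> = restrict_space \<nu> X"
  have em: "emeasure \<mu> A = emeasure \<nu> A" if "A \<subseteq> X" for A
    unfolding \<mu>_def using that sets by (intro emeasure_restrict_space) (auto simp: sp)
  have "emeasure \<nu> X = 1"
  proof (rule antisym[OF \<nu>.emeasure_le_1])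
    show "1 \<le> emeasure \<nu> X" using emeasure_mono[OF K(2) sets(1)] \<nu>(3) by simp
  qed
  then have prob: "prob_space \<mu>"
    using em[of X] by (intro prob_spaceI) (simp add: \<mu>_def space_restrict_space sp)
  have "sets \<mu> = sets (restrict_space borel X)"
    unfolding \<mu>_def by (intro sets_restrict_space_cong \<nu>(2))
  with prob have "\<mu> \<in> borel_prob_measures X" by (simp add: borel_prob_measures_def)
  moreover have "measure \<mu> K = 1" using em[OF K(2)] \<nu>(3) by (simp add: measure_def)
  moreover have "measure \<mu> (bowen_ball X T n x \<epsilon>) \<le> exp (- s * real n) / c" if n: "n \<ge> N" "x \<in> X" for n x
  proof -
    let ?B = "bowen_ball X T n x \<epsilon>"
    have "n \<ge> 1" using n \<open>N \<ge> 1\<close> by simp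
    then obtain U where U: "open U" "?B = X \<inter> U"
      using openin_bowen_ball[OF X] by (metis openin_open)
    \<comment> \<open>The ball is open only relative to \<open>X\<close>; the part of \<open>U\<close> outside \<open>X\<close> has no mass.\<close>
    have "m ((U \<inter> X) \<union> (U - X)) = m (U \<inter> X) + m (U - X)" by (intro m') auto
    moreover have "(U \<inter> X) \<union> (U - X) = U" "U \<inter> X = ?B" using U by auto
    moreover have "m (U - X) \<le> m (- K)" using m'(1,2) by (rule finitely_additive_mono) (use K(2) in auto)
    ultimately have "m U \<le> m ?B" using m'(4) by simp
    have "emeasure \<mu> ?B \<le> emeasure \<nu> U"
      unfolding em[OF bowen_ball_subset] using U by (intro emeasure_mono) (auto simp: \<nu>(2))
    also have "\<dots> \<le> ennreal (m U)" by (rule \<nu>(4)[OF U(1)])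
    also have "\<dots> \<le> ennreal (exp (- s * real n) / c)"
      using \<open>m U \<le> m ?B\<close> m(2)[OF n] by (intro ennreal_leI) simp
    finally show ?thesis using c(1) unfolding measure_def by (intro enn2real_leI) auto
  qed
  ultimately show ?thesis by (rule that)
qed

section \<open>The variational principle for compact sets\<close>

lemma bowen_ball_measurable:
  assumes "tds X T" "\<mu> \<in> borel_prob_measures X" "n \<ge> 1"
  shows "bowen_ball X T n x \<epsilon> \<in> sets \<mu>"
proof -
  obtain U where "open U" "bowen_ball X T n x \<epsilon> = X \<inter> U"
    using openin_bowen_ball[OF assms(1,3)] by (metis openin_open)
  then show ?thesis using assms(2) by (auto simp: borel_prob_measures_def sets_restrict_space)
qed

lemma log_decay_rate_antimono:
  assumes "0 \<le> p" "p \<le> q"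
  shows "log_decay_rate n q \<le> log_decay_rate n p"
proof (cases "p = 0")
  case False
  then have "ln p \<le> ln q" "q \<noteq> 0" using assms by auto
  then show ?thesis
    using False by (auto simp: log_decay_rate_def intro!: ennreal_leI divide_right_mono)
qed (simp add: log_decay_rate_def)

lemma less_log_decay_rateD:
  assumes "ennreal s < log_decay_rate n p" "0 \<le> p" "n \<ge> 1"
  shows "p \<le> exp (- s * real n)"
proof (cases "p = 0")
  case False
  then have "s < - (1 / real n) * ln p"
    using assms(1) ennreal_leI[of "- (1 / real n) * ln p" s]
    by (auto simp: log_decay_rate_def not_le[symmetric])
  then have "ln p < - s * real n" using assms(3) by (simp add: field_simps)
  then have "exp (ln p) \<le> exp (- s * real n)" by simp
  then show ?thesis using False assms(2) by simp
qed simp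

lemma local_lower_entropy_eq_SUP:
  assumes "tds X T" "\<mu> \<in> borel_prob_measures X"
  shows "local_lower_entropy X T \<mu> x =
    (SUP \<epsilon>\<in>{0<..}. liminf (\<lambda>n. log_decay_rate n (measure \<mu> (bowen_ball X T n x \<epsilon>))))"
  unfolding local_lower_entropy_def
proof (rule Lim_at_right_0_antimono)
  fix a b :: real assume ab: "0 < a" "a \<le> b"
  interpret prob_space \<mu> using assms(2) by (simp add: borel_prob_measures_def)
  have "log_decay_rate n (measure \<mu> (bowen_ball X T n x b)) \<le> log_decay_rate n (measure \<mu> (bowen_ball X T n x a))"
    if n: "n \<ge> 1" for n
    using bowen_ball_measurable[OF assms n] bowen_ball_mono[OF ab(2)]
    by (intro log_decay_rate_antimono finite_measure_mono measure_nonneg)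
  then show "liminf (\<lambda>n. log_decay_rate n (measure \<mu> (bowen_ball X T n x b)))
      \<le> liminf (\<lambda>n. log_decay_rate n (measure \<mu> (bowen_ball X T n x a)))"
    by (intro Liminf_mono eventually_sequentiallyI[of 1])
qed

text \<open>The mass distribution principle. If \<open>K\<close> has arbitrarily cheap covers by
  balls of radius \<open>\<epsilon> / 2\<close>, then the set
  of points of \<open>K\<close> at which the balls of radius \<open>\<epsilon>\<close> have mass at most \<open>exp (- s n)\<close> is null: a covering
  ball that contains such a point \<open>y\<close> lies in the ball of radius \<open>\<epsilon>\<close> around \<open>y\<close>, hence has mass at most
  its cost in the cover.\<close>

lemma mass_distribution_null:
  assumes X: "tds X T" and \<mu>: "\<mu> \<in> borel_prob_measures X" and "N \<ge> 1" "\<epsilon> > 0"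
    and zero: "bowen_premeasure X T s N (\<epsilon> / 2) K = 0"
  shows "AE x in \<mu>. \<not> (x \<in> K \<and> (\<forall>n\<ge>N. measure \<mu> (bowen_ball X T n x \<epsilon>) \<le> exp (- s * real n)))"
proof -
  interpret prob_space \<mu> using \<mu> by (simp add: borel_prob_measures_def)
  define E where "E = {x \<in> K. \<forall>n\<ge>N. measure \<mu> (bowen_ball X T n x \<epsilon>) \<le> exp (- s * real n)}"
  have "\<exists>W. W \<in> sets \<mu> \<and> E \<subseteq> W \<and> emeasure \<mu> W \<le> \<delta>" if "\<delta> > 0" for \<delta>
  proof -
    have "bowen_premeasure X T s N (\<epsilon> / 2) K < \<delta>" using zero \<open>\<delta> > 0\<close> by simp
    then obtain I :: "nat set" and n x where I: "\<And>i. i \<in> I \<Longrightarrow> x i \<in> X" "\<And>i. i \<in> I \<Longrightarrow> n i \<ge> N"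
      "K \<subseteq> (\<Union>i\<in>I. bowen_ball X T (n i) (x i) (\<epsilon> / 2))"
      "infsum (\<lambda>i. ennreal (exp (- s * real (n i)))) I < \<delta>"
      by (rule bowen_premeasure_cover) blast
    let ?B = "\<lambda>i. bowen_ball X T (n i) (x i) (\<epsilon> / 2)"
    define J where "J = {i \<in> I. ?B i \<inter> E \<noteq> {}}"
    have n1: "n i \<ge> 1" if "i \<in> J" for i using that I(2)[of i] \<open>N \<ge> 1\<close> by (auto simp: J_def)
    have meas: "?B i \<in> sets \<mu>" if "i \<in> J" for i
      using n1[OF that] by (rule bowen_ball_measurable[OF X \<mu>])
    have ball: "emeasure \<mu> (?B i) \<le> ennreal (exp (- s * real (n i)))" if i: "i \<in> J" for i
    proof -
      obtain y where y: "y \<in> ?B i" "y \<in> E" using i by (auto simp: J_def)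
      have "?B i \<subseteq> bowen_ball X T (n i) y \<epsilon>"
        using bowen_ball_subset_recentred[OF n1[OF i] y(1)] by simp
      then have "emeasure \<mu> (?B i) \<le> emeasure \<mu> (bowen_ball X T (n i) y \<epsilon>)"
        using bowen_ball_measurable[OF X \<mu> n1[OF i]] by (intro emeasure_mono)
      also have "\<dots> \<le> ennreal (exp (- s * real (n i)))"
        unfolding emeasure_eq_measure using y(2) i I(2)[of i]
        by (intro ennreal_leI) (auto simp: E_def J_def)
      finally show ?thesis .
    qed
    have "emeasure \<mu> (\<Union>i\<in>J. ?B i) \<le> infsum (\<lambda>i. emeasure \<mu> (?B i)) J"
      using meas by (rule emeasure_UN_le_infsum)
    also have "\<dots> \<le> infsum (\<lambda>i. ennreal (exp (- s * real (n i)))) J"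
      using ball by (rule infsum_ennreal_mono)
    also have "\<dots> \<le> infsum (\<lambda>i. ennreal (exp (- s * real (n i)))) I"
      by (intro infsum_ennreal_mono_set) (auto simp: J_def)
    also have "\<dots> \<le> \<delta>" using I(4) by simp
    finally have "emeasure \<mu> (\<Union>i\<in>J. ?B i) \<le> \<delta>" .
    moreover have "(\<Union>i\<in>J. ?B i) \<in> sets \<mu>" using meas by (intro sets.countable_UN') auto
    moreover have "E \<subseteq> (\<Union>i\<in>J. ?B i)"
    proof
      fix y assume y: "y \<in> E"
      then obtain i where "i \<in> I" "y \<in> ?B i" using I(3) by (auto simp: E_def)
      then show "y \<in> (\<Union>i\<in>J. ?B i)" using y by (auto simp: J_def)
    qed
    ultimately show ?thesis by blast
  qed
  then have "\<exists>W. W \<in> sets \<mu> \<and> E \<subseteq> W \<and> emeasure \<mu> W \<le> ennreal (inverse (real (Suc j)))" for j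
    by simp
  then obtain W where W: "\<And>j. W j \<in> sets \<mu>" "\<And>j. E \<subseteq> W j"
    "\<And>j. emeasure \<mu> (W j) \<le> ennreal (inverse (real (Suc j)))" by metis
  have "(\<Inter>j. W j) \<in> null_sets \<mu>"
  proof (rule null_setsI)
    have "measure \<mu> (\<Inter>j. W j) \<le> 0"
    proof (rule field_le_epsilon)
      fix e :: real assume "e > 0"
      then obtain j where j: "inverse (real (Suc j)) < e" using reals_Archimedean by blast
      have "emeasure \<mu> (\<Inter>j. W j) \<le> emeasure \<mu> (W j)" using W(1) by (intro emeasure_mono) auto
      also have "\<dots> \<le> ennreal (inverse (real (Suc j)))" by (rule W(3))
      finally show "measure \<mu> (\<Inter>j. W j) \<le> 0 + e" using j by (simp add: emeasure_eq_measure)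
    qed
    then show "emeasure \<mu> (\<Inter>j. W j) = 0" by (simp add: emeasure_eq_measure ennreal_eq_0_iff)
  qed (use W(1) in auto)
  moreover have "{x \<in> space \<mu>. \<not> \<not> (x \<in> K \<and> (\<forall>n\<ge>N. measure \<mu> (bowen_ball X T n x \<epsilon>) \<le> exp (- s * real n)))} \<subseteq> (\<Inter>j. W j)"
    using W(2) by (auto simp: E_def)
  ultimately show ?thesis by (rule AE_I')
qed

text \<open>A point with local entropy above \<open>s\<close> satisfies the decay condition of the mass distribution
  principle for some radius \<open>1 / (m + 1)\<close> and all large times; countably many null sets cover these
  points.\<close>

lemma lower_entropy_le:
  assumes X: "tds X T" and K: "compact K" "K \<subseteq> X" and \<mu>: "\<mu> \<in> borel_prob_measures X"
    and "measure \<mu> K = 1" and zero: "bowen_measure X T s K = 0"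
  shows "lower_entropy X T \<mu> \<le> ennreal s"
proof -
  interpret prob_space \<mu> using \<mu> by (simp add: borel_prob_measures_def)
  let ?E = "\<lambda>m N x. x \<in> K \<and>
    (\<forall>n\<ge>Suc N. measure \<mu> (bowen_ball X T n x (inverse (real (Suc m)))) \<le> exp (- s * real n))"
  have "AE x in \<mu>. \<not> ?E m N x" for m N
    using zero by (intro mass_distribution_null[OF X \<mu>]) (auto simp: bowen_measure_eq_0_iff)
  then have 1: "AE x in \<mu>. \<forall>m N. \<not> ?E m N x" by (simp only: AE_all_countable) blast
  have "K = X \<inter> K" using K(2) by auto
  then have "K \<in> sets \<mu>"
    using \<mu> K(1) by (auto simp: borel_prob_measures_def sets_restrict_space compact_imp_closed)
  then have 2: "AE x in \<mu>. x \<in> K" using \<open>measure \<mu> K = 1\<close> by (simp add: prob_eq_1)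
  have "AE x in \<mu>. local_lower_entropy X T \<mu> x \<le> ennreal s"
    using 1 2
  proof eventually_elim
    case (elim x)
    show ?case
    proof (rule ccontr)
      assume "\<not> ?thesis"
      then obtain \<epsilon> where "\<epsilon> > 0"
        and e: "ennreal s < liminf (\<lambda>n. log_decay_rate n (measure \<mu> (bowen_ball X T n x \<epsilon>)))"
        by (auto simp: local_lower_entropy_eq_SUP[OF X \<mu>] not_le less_SUP_iff)
      obtain m where m: "inverse (real (Suc m)) < \<epsilon>" using reals_Archimedean[OF \<open>\<epsilon> > 0\<close>] by blast
      obtain N where N: "\<And>n. n \<ge> N \<Longrightarrow> ennreal s < log_decay_rate n (measure \<mu> (bowen_ball X T n x \<epsilon>))"
        using less_LiminfD[OF e] by (auto simp: eventually_sequentially)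
      have "measure \<mu> (bowen_ball X T n x (inverse (real (Suc m)))) \<le> exp (- s * real n)"
        if n: "n \<ge> Suc N" for n
      proof -
        have "measure \<mu> (bowen_ball X T n x (inverse (real (Suc m)))) \<le> measure \<mu> (bowen_ball X T n x \<epsilon>)"
          using n m by (intro finite_measure_mono bowen_ball_mono bowen_ball_measurable[OF X \<mu>]) auto
        also have "\<dots> \<le> exp (- s * real n)"
          using n N by (intro less_log_decay_rateD) auto
        finally show ?thesis .
      qed
      then show False using elim by blast
    qed
  qed
  then have "lower_entropy X T \<mu> \<le> (\<integral>\<^sup>+ x. ennreal s \<partial>\<mu>)"
    unfolding lower_entropy_def by (rule nn_integral_mono_AE)
  then show ?thesis by (simp add: emeasure_space_1)
qed

text \<open>The factor \<open>1 / c\<close> contributes \<open>ln c / n\<close> to the decay rate, which vanishes in the limit.\<close>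

lemma frostman_lower_entropy:
  assumes X: "tds X T" and \<mu>: "\<mu> \<in> borel_prob_measures X" and c: "0 < c" and "\<epsilon> > 0"
    and decay: "\<And>n x. n \<ge> N \<Longrightarrow> x \<in> X \<Longrightarrow> measure \<mu> (bowen_ball X T n x \<epsilon>) \<le> exp (- s * real n) / c"
  shows "ennreal s \<le> lower_entropy X T \<mu>"
proof -
  interpret prob_space \<mu> using \<mu> by (simp add: borel_prob_measures_def)
  have "space \<mu> = X"
    using \<mu> sets_eq_imp_space_eq[of \<mu> "restrict_space borel X"]
    by (auto simp: borel_prob_measures_def space_restrict_space)
  have "ennreal s \<le> local_lower_entropy X T \<mu> x" if x: "x \<in> X" for x
  proof -
    have "(\<lambda>n. s + ln c / real n) \<longlonglongrightarrow> s + 0"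
      by (intro tendsto_add tendsto_const lim_const_over_n)
    then have "(\<lambda>n. ennreal (s + ln c / real n)) \<longlonglongrightarrow> ennreal s" by (intro tendsto_ennrealI) simp
    then have "ennreal s = liminf (\<lambda>n. ennreal (s + ln c / real n))"
      by (intro lim_imp_Liminf[symmetric]) auto
    also have "\<dots> \<le> liminf (\<lambda>n. log_decay_rate n (measure \<mu> (bowen_ball X T n x \<epsilon>)))"
    proof (intro Liminf_mono eventually_sequentiallyI[of "max 1 N"])
      fix n assume n: "max 1 N \<le> n"
      have "- (1 / real n) * ln (exp (- s * real n) / c) = s + ln c / real n"
        using n c by (simp add: ln_div field_simps)
      then have "ennreal (s + ln c / real n) = log_decay_rate n (exp (- s * real n) / c)"
        using c by (simp add: log_decay_rate_def)
      also have "\<dots> \<le> log_decay_rate n (measure \<mu> (bowen_ball X T n x \<epsilon>))"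
        using n x by (intro log_decay_rate_antimono decay) auto
      finally show "ennreal (s + ln c / real n) \<le> log_decay_rate n (measure \<mu> (bowen_ball X T n x \<epsilon>))" .
    qed
    also have "\<dots> \<le> local_lower_entropy X T \<mu> x"
      unfolding local_lower_entropy_eq_SUP[OF X \<mu>] using \<open>\<epsilon> > 0\<close> by (intro SUP_upper) auto
    finally show ?thesis .
  qed
  then have "(\<integral>\<^sup>+ x. ennreal s \<partial>\<mu>) \<le> lower_entropy X T \<mu>"
    unfolding lower_entropy_def using \<open>space \<mu> = X\<close> by (intro nn_integral_mono) auto
  then show ?thesis by (simp add: emeasure_space_1)
qed

theorem compact_variational_principle:
  assumes X: "tds X T" and K: "compact K" "K \<subseteq> X"
  shows "bowen_entropy X T K =
    (SUP \<mu>\<in>{\<mu> \<in> borel_prob_measures X. measure \<mu> K = 1}. lower_entropy X T \<mu>)"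
proof (rule antisym)
  show "(SUP \<mu>\<in>{\<mu> \<in> borel_prob_measures X. measure \<mu> K = 1}. lower_entropy X T \<mu>) \<le> bowen_entropy X T K"
    unfolding bowen_entropy_def using lower_entropy_le[OF X K] by (auto intro!: SUP_least Inf_greatest)
  show "bowen_entropy X T K \<le> (SUP \<mu>\<in>{\<mu> \<in> borel_prob_measures X. measure \<mu> K = 1}. lower_entropy X T \<mu>)"
  proof (rule dense_le)
    fix t assume t: "t < bowen_entropy X T K"
    then obtain s where s: "t = ennreal s" "s \<ge> 0" by (cases t) auto
    obtain N \<epsilon> where e: "\<epsilon> > 0" "N \<ge> 1" "bowen_premeasure X T s N \<epsilon> K > 0"
      by (rule less_bowen_entropyE[OF t[unfolded s(1)] s(2)])
    obtain c where c: "0 < c" "ennreal c \<le> bowen_premeasure X T s N (3 * (\<epsilon> / 3)) K"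
    proof (cases "bowen_premeasure X T s N \<epsilon> K")
      case (real r)
      then show ?thesis using e(3) that[of r] by auto
    next
      case top
      then show ?thesis using that[of 1] by auto
    qed
    have "\<epsilon> / 3 > 0" using e(1) by simp
    obtain \<mu> where \<mu>: "\<mu> \<in> borel_prob_measures X" "measure \<mu> K = 1"
      "\<And>n x. n \<ge> N \<Longrightarrow> x \<in> X \<Longrightarrow> measure \<mu> (bowen_ball X T n x (\<epsilon> / 3)) \<le> exp (- s * real n) / c"
      by (rule frostman[OF X K \<open>\<epsilon> / 3 > 0\<close> e(2) c]) blast
    have "t \<le> lower_entropy X T \<mu>"
      unfolding s(1) by (rule frostman_lower_entropy[OF X \<mu>(1) c(1) \<open>\<epsilon> / 3 > 0\<close> \<mu>(3)])
    also have "\<dots> \<le> (SUP \<mu>\<in>{\<mu> \<in> borel_prob_measures X. measure \<mu> K = 1}. lower_entropy X T \<mu>)"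
      using \<mu> by (intro SUP_upper) auto
    finally show "t \<le> (SUP \<mu>\<in>{\<mu> \<in> borel_prob_measures X. measure \<mu> K = 1}. lower_entropy X T \<mu>)" .
  qed
qed

section \<open>Cluster points and boxes in product spaces\<close>

lemma compact_cluster_point:
  fixes y :: "nat \<Rightarrow> 'b::topological_space"
  assumes "compact S" "\<And>k. y k \<in> S"
  obtains x where "x \<in> S" "\<And>U k0. open U \<Longrightarrow> x \<in> U \<Longrightarrow> \<exists>k\<ge>k0. y k \<in> U"
proof -
  have "S \<inter> (\<Inter>k0\<in>UNIV. closure (y ` {k0..})) \<noteq> {}"
  proof (rule compact_imp_fip_image[OF assms(1)])
    fix I :: "nat set" assume "finite I"
    then obtain m where "\<And>k0. k0 \<in> I \<Longrightarrow> k0 \<le> m" by (metis finite_nat_set_iff_bounded_le)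
    then have "y m \<in> S \<inter> (\<Inter>k0\<in>I. closure (y ` {k0..}))"
      using assms(2) by (auto intro!: closure_subset[THEN subsetD])
    then show "S \<inter> (\<Inter>k0\<in>I. closure (y ` {k0..})) \<noteq> {}" by blast
  qed simp
  then obtain x where x: "x \<in> S" "\<And>k0. x \<in> closure (y ` {k0..})" by blast
  have "\<exists>k\<ge>k0. y k \<in> U" if "open U" "x \<in> U" for U k0
  proof -
    have "U \<inter> y ` {k0..} \<noteq> {}"
      using open_Int_closure_eq_empty[OF \<open>open U\<close>] x(2)[of k0] \<open>x \<in> U\<close> by blast
    then show ?thesis by auto
  qed
  then show ?thesis using that x(1) by blast
qed

text \<open>A sequence of subsets accumulates, in the compact space of all subsets with the product topology,
  at some subset \<open>C\<close>.\<close>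

lemma set_sequence_cluster:
  fixes F :: "nat \<Rightarrow> 'i set"
  obtains C where "\<And>S k0. finite S \<Longrightarrow> \<exists>k\<ge>k0. F k \<inter> S = C \<inter> S"
proof -
  let ?y = "\<lambda>k i. if i \<in> F k then 1 else 0 :: real"
  have "compact {x :: 'i \<Rightarrow> real. \<forall>i. x i \<in> {0, 1}}" by (rule compact_PiE_UNIV) auto
  then obtain x :: "'i \<Rightarrow> real" where x: "\<And>i. x i \<in> {0, 1}"
    "\<And>U k0. open U \<Longrightarrow> x \<in> U \<Longrightarrow> \<exists>k\<ge>k0. ?y k \<in> U"
    by (rule compact_cluster_point[of _ ?y]) auto
  have "\<exists>k\<ge>k0. F k \<inter> S = {i. x i = 1} \<inter> S" if "finite S" for S k0
  proof -
    define V where "V i = (if i \<in> S then {x i - 1/2 <..< x i + 1/2} else UNIV)" for i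
    have "open (PiE UNIV V)"
      using that by (intro open_PiE) (auto simp: V_def intro: finite_subset[of _ S])
    moreover have "x \<in> PiE UNIV V" by (auto simp: V_def)
    ultimately obtain k where k: "k \<ge> k0" "?y k \<in> PiE UNIV V" using x(2) by blast
    have "i \<in> F k \<longleftrightarrow> x i = 1" if "i \<in> S" for i
    proof -
      have "?y k i \<in> V i" using k(2) by (auto simp: PiE_iff)
      then show ?thesis using x(1)[of i] that by (auto simp: V_def split: if_splits)
    qed
    then show ?thesis using k(1) by blast
  qed
  then show ?thesis by (rule that)
qed

text \<open>A neighbourhood of a compact box of sequences contains every sequence that obeys sufficiently many
  of the bounds defining the box; the later entries may be arbitrary. This is what lets finitely many
  bounds control the images of the boxes in a Souslin scheme.\<close>

lemma product_box_tube:
  fixes m :: "nat \<Rightarrow> nat"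
  assumes "open W" "{x. \<forall>i. x i \<le> m i} \<subseteq> W"
  shows "\<exists>k. {x. \<forall>i<k. x i \<le> m i} \<subseteq> W"
proof (rule ccontr)
  assume "\<not> ?thesis"
  then have "\<forall>k. \<exists>x. (\<forall>i<k. x i \<le> m i) \<and> x \<notin> W" by blast
  then obtain x where x: "\<And>k i. i < k \<Longrightarrow> x k i \<le> m i" "\<And>k. x k \<notin> W" by metis
  have box: "compact {x :: nat \<Rightarrow> nat. \<forall>i. x i \<in> {..m i}}"
    by (rule compact_PiE_UNIV) (auto intro: finite_imp_compact)
  obtain y where y: "y \<in> {x. \<forall>i. x i \<in> {..m i}}"
    "\<And>U k0. open U \<Longrightarrow> y \<in> U \<Longrightarrow> \<exists>k\<ge>k0. (\<lambda>i. min (x k i) (m i)) \<in> U"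
    by (rule compact_cluster_point[OF box, of "\<lambda>k i. min (x k i) (m i)"]) auto
  have "openin (product_topology (\<lambda>i. euclidean) UNIV) W"
    using assms(1) by (simp add: euclidean_product_topology)
  moreover have "y \<in> W" using y(1) assms(2) by auto
  ultimately obtain V where V: "y \<in> PiE UNIV V" "\<And>i. open (V i)" "finite {i. V i \<noteq> UNIV}" "PiE UNIV V \<subseteq> W"
    using product_topology_open_contains_basis[of "\<lambda>i. euclidean" UNIV W y] by auto
  obtain k0 where k0: "\<And>i. V i \<noteq> UNIV \<Longrightarrow> i < k0"
    using V(3) by (auto simp: finite_nat_set_iff_bounded)
  have "open (PiE UNIV V)" using V by (intro open_PiE) auto
  then obtain k where k: "k \<ge> k0" "(\<lambda>i. min (x k i) (m i)) \<in> PiE UNIV V" using y(2) V(1) by blast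
  have "x k i \<in> V i" for i
  proof (cases "V i = UNIV")
    case False
    then have "x k i \<le> m i" using k0 k(1) by (intro x) force
    then have "min (x k i) (m i) = x k i" by simp
    then show ?thesis using k(2) by (metis PiE_mem UNIV_I)
  qed simp
  then have "x k \<in> PiE UNIV V" by auto
  then show False using V(4) x(2) by blast
qed

section \<open>Contents given by countable covers\<close>

text \<open>This models covers by Bowen balls whose centres are restricted to a finite net for each time,
  with the time as level. Finiteness at each level makes the families of covering sets
  behave like a compact space: families agreeing on low levels differ only at high levels.\<close>

locale graded_family =
  fixes D :: "'i set" and lev :: "'i \<Rightarrow> nat" and B :: "'i \<Rightarrow> 'b::topological_space set"
  assumes finite_levels: "finite {p \<in> D. lev p \<le> L}"
begin

definition cost :: "real \<Rightarrow> 'i set \<Rightarrow> ennreal" where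
  "cost s F = infsum (\<lambda>p. ennreal (exp (- s * real (lev p)))) F"

definition content :: "real \<Rightarrow> 'b set \<Rightarrow> ennreal" where
  "content s A = Inf {cost s F | F. F \<subseteq> D \<and> A \<subseteq> (\<Union>p\<in>F. B p)}"

lemma content_le: "F \<subseteq> D \<Longrightarrow> A \<subseteq> (\<Union>p\<in>F. B p) \<Longrightarrow> content s A \<le> cost s F"
  unfolding content_def by (rule Inf_lower) blast

lemma content_lessE:
  assumes "content s A < c"
  obtains F where "F \<subseteq> D" "A \<subseteq> (\<Union>p\<in>F. B p)" "cost s F < c"
  using assms unfolding content_def Inf_less_iff by blast

lemma countable_family: "F \<subseteq> D \<Longrightarrow> countable F"
proof (rule countable_subset)
  have "D = (\<Union>L. {p \<in> D. lev p \<le> L})" by auto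
  also have "countable \<dots>" using finite_levels by (intro countable_UN) (auto intro: countable_finite)
  finally show "countable D" .
qed

lemma cost_antimono: "s \<le> s' \<Longrightarrow> cost s' F \<le> cost s F"
  unfolding cost_def by (intro infsum_ennreal_mono ennreal_leI) (simp add: mult_right_mono)

lemma cost_high_levels:
  assumes "s \<le> s'" "\<And>p. p \<in> G \<Longrightarrow> L \<le> lev p"
  shows "cost s' G \<le> ennreal (exp (- (s' - s) * real L)) * cost s G"
  unfolding cost_def
proof (rule infsum_ennreal_leI)
  fix F assume F: "finite F" "F \<subseteq> G"
  have "(\<Sum>p\<in>F. ennreal (exp (- s' * real (lev p))))
      \<le> (\<Sum>p\<in>F. ennreal (exp (- (s' - s) * real L)) * ennreal (exp (- s * real (lev p))))"
  proof (rule sum_mono)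
    fix p assume "p \<in> F"
    then have "(s' - s) * real L \<le> (s' - s) * real (lev p)"
      using assms F(2) by (intro mult_left_mono) auto
    then have "exp (- s' * real (lev p)) \<le> exp (- (s' - s) * real L) * exp (- s * real (lev p))"
      by (simp add: exp_add[symmetric] algebra_simps)
    then show "ennreal (exp (- s' * real (lev p))) \<le> ennreal (exp (- (s' - s) * real L)) * ennreal (exp (- s * real (lev p)))"
      by (simp add: ennreal_mult[symmetric] ennreal_leI)
  qed
  also have "\<dots> \<le> ennreal (exp (- (s' - s) * real L)) * infsum (\<lambda>p. ennreal (exp (- s * real (lev p)))) G"
    unfolding sum_distrib_left[symmetric] using F by (intro mult_left_mono sum_le_infsum_ennreal) auto
  finally show "(\<Sum>p\<in>F. ennreal (exp (- s' * real (lev p))))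
      \<le> ennreal (exp (- (s' - s) * real L)) * infsum (\<lambda>p. ennreal (exp (- s * real (lev p)))) G" .
qed

text \<open>An increasing sets lemma, at the price of a slightly larger exponent. Let \<open>F k\<close> be covers of \<open>A k\<close> of
  cost below \<open>M'\<close>, and let \<open>C\<close> be a cluster point of these families. The cost of \<open>C\<close> is at most \<open>M'\<close>. A
  point of \<open>A j\<close> missed by \<open>C\<close> is covered by all \<open>F k\<close> with \<open>k \<ge> j\<close>, and for suitable \<open>k\<close> only by sets of
  high level, as \<open>F k\<close> agrees with \<open>C\<close> on low levels. So the missed part of \<open>A j\<close> has covers of
  arbitrarily high level and bounded cost for \<open>s\<close>, which are arbitrarily cheap for \<open>s'\<close>; adding these
  for all \<open>j\<close> to \<open>C\<close> costs next to nothing.\<close>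

lemma content_increasing_union:
  assumes inc: "\<And>j k. j \<le> k \<Longrightarrow> A j \<subseteq> A k" and bound: "\<And>k. content s (A k) \<le> M" and "s < s'"
  shows "content s' (\<Union>k::nat. A k) \<le> M"
proof (rule dense_ge)
  fix M' assume "M < M'"
  show "content s' (\<Union>k. A k) \<le> M'"
  proof (cases M')
    case (real r)
    have "\<exists>F. F \<subseteq> D \<and> A k \<subseteq> (\<Union>p\<in>F. B p) \<and> cost s F < M'" for k
      using content_lessE[OF order_le_less_trans[OF bound[of k] \<open>M < M'\<close>]] by metis
    then obtain F where F: "\<And>k. F k \<subseteq> D" "\<And>k. A k \<subseteq> (\<Union>p\<in>F k. B p)" "\<And>k. cost s (F k) < M'"
      by metis
    obtain C where C: "\<And>S k0. finite S \<Longrightarrow> \<exists>k\<ge>k0. F k \<inter> S = C \<inter> S"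
      by (rule set_sequence_cluster[of F]) blast
    have "C \<subseteq> D"
    proof
      fix p assume "p \<in> C"
      obtain k where "F k \<inter> {p} = C \<inter> {p}" using C[of "{p}"] by auto
      then show "p \<in> D" using F(1)[of k] \<open>p \<in> C\<close> by blast
    qed
    have cost_C: "cost s C \<le> M'"
      unfolding cost_def
    proof (rule infsum_ennreal_leI)
      fix S assume S: "finite S" "S \<subseteq> C"
      obtain k where k: "F k \<inter> S = C \<inter> S" using C[OF S(1)] by auto
      have "sum (\<lambda>p. ennreal (exp (- s * real (lev p)))) S \<le> cost s (F k)"
        unfolding cost_def using k S by (intro sum_le_infsum_ennreal) auto
      then show "sum (\<lambda>p. ennreal (exp (- s * real (lev p)))) S \<le> M'"
        using F(3)[of k] by (meson order_trans less_imp_le)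
    qed
    \<comment> \<open>Points of \<open>A j\<close> missed by \<open>C\<close> can be covered at arbitrarily high levels at bounded cost.\<close>
    have high: "\<exists>G. G \<subseteq> D \<and> A j - (\<Union>p\<in>C. B p) \<subseteq> (\<Union>p\<in>G. B p) \<and> (\<forall>p\<in>G. L \<le> lev p) \<and> cost s G \<le> M'" for j L
    proof -
      obtain k where k: "k \<ge> j" "F k \<inter> {p \<in> D. lev p \<le> L} = C \<inter> {p \<in> D. lev p \<le> L}"
        using C[OF finite_levels] by blast
      let ?G = "F k - {p. lev p \<le> L}"
      have "A j - (\<Union>p\<in>C. B p) \<subseteq> (\<Union>p\<in>?G. B p)"
      proof
        fix x assume x: "x \<in> A j - (\<Union>p\<in>C. B p)"
        then obtain p where "p \<in> F k" "x \<in> B p" using inc[OF k(1)] F(2)[of k] by blast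
        then show "x \<in> (\<Union>p\<in>?G. B p)" using x k(2) F(1)[of k] by blast
      qed
      moreover have "cost s ?G \<le> cost s (F k)"
        unfolding cost_def by (intro infsum_ennreal_mono_set) auto
      moreover have "\<forall>p\<in>?G. L \<le> lev p" by auto
      ultimately show ?thesis using F(1,3)[of k] by (intro exI[of _ ?G]) (auto intro: order_trans less_imp_le)
    qed
    show ?thesis
    proof (rule ennreal_le_epsilon)
      fix \<delta> :: real assume "\<delta> > 0"
      have "\<exists>G. G \<subseteq> D \<and> A j - (\<Union>p\<in>C. B p) \<subseteq> (\<Union>p\<in>G. B p) \<and> cost s' G \<le> ennreal (\<delta> * (1/2) ^ Suc j)" for j
      proof -
        define y where "y = \<delta> * (1/2) ^ Suc j / (r + 1)"
        have "y > 0" using \<open>\<delta> > 0\<close> real by (simp add: y_def)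
        moreover have "exp (- (s' - s)) < 1" using \<open>s < s'\<close> by simp
        ultimately obtain L where L: "exp (- (s' - s)) ^ L < y" using real_arch_pow_inv by blast
        obtain G where G: "G \<subseteq> D" "A j - (\<Union>p\<in>C. B p) \<subseteq> (\<Union>p\<in>G. B p)" "\<forall>p\<in>G. L \<le> lev p" "cost s G \<le> M'"
          using high[of j L] by (elim exE conjE)
        have "cost s' G \<le> ennreal (exp (- (s' - s) * real L)) * cost s G"
          using G(3) \<open>s < s'\<close> by (intro cost_high_levels) auto
        also have "\<dots> \<le> ennreal y * ennreal r"
          using L G(4) real by (intro mult_mono ennreal_leI) (auto simp: exp_of_nat2_mult)
        also have "\<dots> = ennreal (y * r)" using real \<open>y > 0\<close> by (simp add: ennreal_mult)
        also have "y * r \<le> \<delta> * (1/2) ^ Suc j"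
        proof -
          have "y * r \<le> y * (r + 1)" using \<open>y > 0\<close> by (intro mult_left_mono) auto
          also have "\<dots> = \<delta> * (1/2) ^ Suc j"
            using nonzero_eq_divide_eq[of "r + 1" y "\<delta> * (1/2) ^ Suc j"] y_def real(1) by linarith
          finally show ?thesis .
        qed
        finally have "cost s' G \<le> ennreal (\<delta> * (1/2) ^ Suc j)" by (simp add: ennreal_leI)
        then show ?thesis using G by blast
      qed
      then obtain G where G: "\<And>j. G j \<subseteq> D" "\<And>j. A j - (\<Union>p\<in>C. B p) \<subseteq> (\<Union>p\<in>G j. B p)"
        "\<And>j. cost s' (G j) \<le> ennreal (\<delta> * (1/2) ^ Suc j)" by metis
      have "content s' (\<Union>k. A k) \<le> cost s' (C \<union> (\<Union>j. G j))"
      proof (rule content_le)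
        show "C \<union> (\<Union>j. G j) \<subseteq> D" using \<open>C \<subseteq> D\<close> G(1) by blast
        show "(\<Union>k. A k) \<subseteq> (\<Union>p\<in>C \<union> (\<Union>j. G j). B p)"
        proof
          fix x assume "x \<in> (\<Union>k. A k)"
          then obtain j where "x \<in> A j" by blast
          then have "x \<in> (\<Union>p\<in>C. B p) \<or> x \<in> (\<Union>p\<in>G j. B p)" using G(2)[of j] by blast
          then show "x \<in> (\<Union>p\<in>C \<union> (\<Union>j. G j). B p)" by blast
        qed
      qed
      also have "\<dots> \<le> cost s' C + cost s' (\<Union>j. G j)"
        unfolding cost_def by (rule infsum_ennreal_Un_le)
      also have "\<dots> \<le> M' + ennreal \<delta>"
      proof (rule add_mono)
        show "cost s' C \<le> M'" using cost_C cost_antimono[of s s' C] \<open>s < s'\<close> by simp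
        have "cost s' (\<Union>j. G j) \<le> (\<Sum>j. cost s' (G j))"
          unfolding cost_def by (rule infsum_ennreal_UN_le)
        also have "\<dots> \<le> (\<Sum>j. ennreal (\<delta> * (1/2) ^ Suc j))" by (intro suminf_le G) auto
        also have "\<dots> = ennreal \<delta>"
          using \<open>\<delta> > 0\<close> by (intro suminf_ennreal_half_powers) simp
        finally show "cost s' (\<Union>j. G j) \<le> ennreal \<delta>" .
      qed
      finally show "content s' (\<Union>k. A k) \<le> M' + ennreal \<delta>" .
    qed
  qed simp
qed

text \<open>The capacitability argument. Bounds \<open>m 0, m 1, \<dots>\<close> on the entries of the coding sequences are chosen
  one after another so that the content stays above \<open>M\<close>; by the increasing sets lemma each choice costs
  a little of the exponent, so a decreasing sequence of exponents \<open>\<sigma> k\<close> between \<open>s0\<close> and \<open>s\<close> is prepared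
  in advance. The sequences obeying all bounds form a compact box, and a cover of its image by
  open sets covers already the image of the sequences obeying finitely many bounds.\<close>

lemma content_analytic:
  fixes f :: "(nat \<Rightarrow> nat) \<Rightarrow> 'b"
  assumes f: "continuous_on UNIV f" and op: "\<And>p. p \<in> D \<Longrightarrow> openin (top_of_set X) (B p)"
    and "range f \<subseteq> X" and M: "M < content s (range f)" and "s0 < s"
  obtains K where "compact K" "K \<subseteq> range f" "M \<le> content s0 K"
proof -
  define \<sigma> where "\<sigma> k = s0 + (s - s0) / 2 ^ k" for k :: nat
  have \<sigma>_step: "\<sigma> (Suc k) < \<sigma> k" and \<sigma>_gt: "s0 < \<sigma> k" for k
    using \<open>s0 < s\<close> by (auto simp: \<sigma>_def field_simps)
  let ?C = "\<lambda>k (m :: nat \<Rightarrow> nat). f ` {x. \<forall>i<k. x i \<le> m i}"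
  have "\<exists>h. \<forall>k. M < content (\<sigma> k) (?C k (h k)) \<and> (\<exists>j. h (Suc k) = (h k)(k := j))"
  proof (rule dependent_nat_choice)
    show "\<exists>m. M < content (\<sigma> 0) (?C 0 m)" using M by (simp add: \<sigma>_def)
    fix m k assume m: "M < content (\<sigma> k) (?C k m)"
    have "\<exists>j. M < content (\<sigma> (Suc k)) (?C (Suc k) (m(k := j)))"
    proof (rule ccontr)
      assume "\<not> ?thesis"
      then have le: "content (\<sigma> (Suc k)) (?C (Suc k) (m(k := j))) \<le> M" for j by (simp add: not_less)
      have "?C (Suc k) (m(k := j)) \<subseteq> ?C (Suc k) (m(k := j'))" if "j \<le> j'" for j j'
        using that by (intro image_mono Collect_mono) (auto intro: order_trans)
      then have "content (\<sigma> k) (\<Union>j. ?C (Suc k) (m(k := j))) \<le> M"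
        using le \<sigma>_step by (rule content_increasing_union)
      moreover have "?C k m = (\<Union>j. ?C (Suc k) (m(k := j)))"
        by (auto simp: less_Suc_eq image_iff)
      ultimately show False using m by simp
    qed
    then show "\<exists>m'. M < content (\<sigma> (Suc k)) (?C (Suc k) m') \<and> (\<exists>j. m' = m(k := j))" by blast
  qed
  then obtain h where h: "\<And>k. M < content (\<sigma> k) (?C k (h k))" "\<And>k. \<exists>j. h (Suc k) = (h k)(k := j)"
    by blast
  define m where "m i = h (Suc i) i" for i
  have h_m: "h k i = m i" if "i < k" for i k
    using that
  proof (induction k)
    case (Suc k)
    then show ?case using h(2)[of k] by (cases "i = k") (auto simp: m_def)
  qed simp
  let ?K = "f ` {x. \<forall>i. x i \<le> m i}"
  have "compact {x :: nat \<Rightarrow> nat. \<forall>i. x i \<in> {..m i}}"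
    by (rule compact_PiE_UNIV) (auto intro: finite_imp_compact)
  then have K: "compact ?K"
    using continuous_on_subset[OF f] by (intro compact_continuous_image) auto
  have "M \<le> content s0 ?K"
  proof (rule ccontr)
    assume "\<not> ?thesis"
    then obtain F where F: "F \<subseteq> D" "?K \<subseteq> (\<Union>p\<in>F. B p)" "cost s0 F < M"
      using content_lessE[of s0 ?K M] by (auto simp: not_le)
    have "openin (top_of_set X) (\<Union>p\<in>F. B p)" using op F(1) by (intro openin_Union) auto
    then obtain U where U: "open U" "(\<Union>p\<in>F. B p) = X \<inter> U" by (auto simp: openin_open)
    have "open (f -` U)" using f U(1) by (simp add: continuous_on_open_vimage)
    moreover have "{x. \<forall>i. x i \<le> m i} \<subseteq> f -` U" using F(2) U(2) by blast
    ultimately obtain k where k: "{x. \<forall>i<k. x i \<le> m i} \<subseteq> f -` U" using product_box_tube by blast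
    have "?C k (h k) = ?C k m" using h_m by (intro arg_cong[where f = "image f"]) auto
    then have "M < content (\<sigma> k) (?C k m)" using h(1)[of k] by simp
    also have "\<dots> \<le> cost (\<sigma> k) F"
      using k U(2) \<open>range f \<subseteq> X\<close> by (intro content_le F) blast
    also have "\<dots> \<le> cost s0 F" using \<sigma>_gt[of k] by (intro cost_antimono) simp
    finally show False using F(3) by simp
  qed
  then show ?thesis using K by (intro that[of ?K]) auto
qed

end

section \<open>Approximation of analytic sets from inside\<close>

lemma finite_bowen_net:
  assumes X: "tds X T" and "n \<ge> 1" "\<epsilon> > 0"
  shows "\<exists>E\<subseteq>X. finite E \<and> X \<subseteq> (\<Union>z\<in>E. bowen_ball X T n z \<epsilon>)"
proof -
  have "\<forall>z. \<exists>U. open U \<and> bowen_ball X T n z \<epsilon> = X \<inter> U"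
    using openin_bowen_ball[OF X \<open>n \<ge> 1\<close>] by (auto simp: openin_open)
  then obtain U where U: "\<And>z. open (U z)" "\<And>z. bowen_ball X T n z \<epsilon> = X \<inter> U z" by metis
  have "compact X" using X by (simp add: tds_def)
  moreover have "X \<subseteq> (\<Union>z\<in>X. U z)" using centre_in_bowen_ball[OF \<open>n \<ge> 1\<close> _ \<open>\<epsilon> > 0\<close>] U(2) by blast
  ultimately obtain E where "E \<subseteq> X" "finite E" "X \<subseteq> (\<Union>z\<in>E. U z)"
    using U(1) by (meson compactE_image)
  then show ?thesis using U(2) by (intro exI[of _ E]) auto
qed

text \<open>Covers by arbitrary Bowen balls of radius \<open>\<epsilon> / 2\<close> and covers by balls of radius \<open>\<epsilon>\<close> around
  the points of finite nets refine each other up to this change of radius, so that the net content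
  can be compared with Bowen's premeasures from both sides.\<close>

lemma analytic_compact_approximation:
  fixes X :: "'a::metric_space set"
  assumes X: "tds X T" and Z: "Z \<subseteq> X" "analytic_set Z" and s: "0 \<le> s0" "s0 < s" "ennreal s < bowen_entropy X T Z"
  shows "\<exists>K. compact K \<and> K \<subseteq> Z \<and> ennreal s0 \<le> bowen_entropy X T K"
proof -
  obtain f :: "(nat \<Rightarrow> nat) \<Rightarrow> 'a" where f: "continuous_on UNIV f" "Z = range f"
    using Z(2) by (auto simp: analytic_set_def)
  obtain N \<epsilon> where e: "\<epsilon> > 0" "N \<ge> 1" "bowen_premeasure X T s N \<epsilon> Z > 0"
    using less_bowen_entropyE[OF s(3)] s(1,2) by (metis less_eq_real_def order_trans)
  have "\<exists>E. n \<ge> N \<longrightarrow> E \<subseteq> X \<and> finite E \<and> X \<subseteq> (\<Union>z\<in>E. bowen_ball X T n z (\<epsilon> / 2))" for n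
    using finite_bowen_net[OF X, of n "\<epsilon> / 2"] e(1,2) by auto
  then obtain E where E: "\<And>n. n \<ge> N \<Longrightarrow> E n \<subseteq> X \<and> finite (E n) \<and> X \<subseteq> (\<Union>z\<in>E n. bowen_ball X T n z (\<epsilon> / 2))"
    by metis
  define D where "D = {p. N \<le> fst p \<and> snd p \<in> E (fst p)}"
  interpret graded_family D fst "\<lambda>p. bowen_ball X T (fst p) (snd p) \<epsilon>"
  proof
    fix L
    have "{p \<in> D. fst p \<le> L} \<subseteq> (SIGMA n:{N..L}. E n)" by (auto simp: D_def)
    then show "finite {p \<in> D. fst p \<le> L}" by (rule finite_subset) (use E in auto)
  qed
  have "bowen_premeasure X T s N \<epsilon> Z \<le> content s Z"
    unfolding content_def
  proof (rule Inf_greatest, clarify)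
    fix F assume F: "F \<subseteq> D" "Z \<subseteq> (\<Union>p\<in>F. bowen_ball X T (fst p) (snd p) \<epsilon>)"
    have "N \<le> fst p \<and> snd p \<in> X" if "p \<in> F" for p using F(1) E that by (force simp: D_def)
    then show "bowen_premeasure X T s N \<epsilon> Z \<le> cost s F"
      unfolding cost_def using F(2) countable_family[OF F(1)]
      by (intro bowen_premeasure_le[where x = snd]) auto
  qed
  then have "0 < content s Z" using e(3) by simp
  then obtain M where M: "0 < M" "M < content s (range f)" using dense f(2) by blast
  obtain K where K: "compact K" "K \<subseteq> range f" "M \<le> content s0 K"
  proof (rule content_analytic[OF f(1) _ _ M(2) s(2)])
    show "openin (top_of_set X) (bowen_ball X T (fst p) (snd p) \<epsilon>)" if "p \<in> D" for p
      using that e(2) by (intro openin_bowen_ball[OF X]) (auto simp: D_def)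
    show "range f \<subseteq> X" using Z(1) f(2) by simp
  qed
  have "content s0 K \<le> bowen_premeasure X T s0 N (\<epsilon> / 2) K"
  proof (rule dense_ge)
    fix c assume "bowen_premeasure X T s0 N (\<epsilon> / 2) K < c"
    then obtain I :: "nat set" and n x where I: "\<And>i. i \<in> I \<Longrightarrow> x i \<in> X" "\<And>i. i \<in> I \<Longrightarrow> n i \<ge> N"
      "K \<subseteq> (\<Union>i\<in>I. bowen_ball X T (n i) (x i) (\<epsilon> / 2))"
      "infsum (\<lambda>i. ennreal (exp (- s0 * real (n i)))) I < c"
      by (rule bowen_premeasure_cover) blast
    have "\<exists>z\<in>E (n i). bowen_ball X T (n i) (x i) (\<epsilon> / 2) \<subseteq> bowen_ball X T (n i) z \<epsilon>" if i: "i \<in> I" for i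
    proof -
      have n: "n i \<ge> 1" using I(2)[OF i] e(2) by simp
      obtain z where z: "z \<in> E (n i)" "x i \<in> bowen_ball X T (n i) z (\<epsilon> / 2)"
        using E[OF I(2)[OF i]] I(1)[OF i] by blast
      then have "z \<in> bowen_ball X T (n i) (x i) (\<epsilon> / 2)"
        using E[OF I(2)[OF i]] by (auto simp: mem_bowen_ball[OF n] dist_commute)
      from bowen_ball_subset_recentred[OF n this] show ?thesis using z(1) by auto
    qed
    then obtain z where z: "\<And>i. i \<in> I \<Longrightarrow> z i \<in> E (n i)"
      "\<And>i. i \<in> I \<Longrightarrow> bowen_ball X T (n i) (x i) (\<epsilon> / 2) \<subseteq> bowen_ball X T (n i) (z i) \<epsilon>"
      by metis
    have "content s0 K \<le> cost s0 ((\<lambda>i. (n i, z i)) ` I)"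
    proof (rule content_le)
      show "(\<lambda>i. (n i, z i)) ` I \<subseteq> D" using z(1) I(2) by (auto simp: D_def)
      show "K \<subseteq> (\<Union>p\<in>(\<lambda>i. (n i, z i)) ` I. bowen_ball X T (fst p) (snd p) \<epsilon>)"
        using I(3) z(2) by fastforce
    qed
    also have "\<dots> \<le> infsum (\<lambda>i. ennreal (exp (- s0 * real (n i)))) I"
      unfolding cost_def 
      using infsum_ennreal_image_le[of "\<lambda>p. ennreal (exp (- s0 * real (fst p)))" "\<lambda>i. (n i, z i)" I]
      by simp
    finally show "content s0 K \<le> c" using I(4) by simp
  qed
  then have "0 < bowen_premeasure X T s0 N (\<epsilon> / 2) K" using M(1) K(3) by (meson order_less_le_trans)
  then have "ennreal s0 \<le> bowen_entropy X T K" using e(1) bowen_entropy_geI[of X T s0 N "\<epsilon> / 2" K] by simp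
  then show ?thesis using K f(2) by blast
qed

theorem analytic_inner_regularity:
  fixes X :: "'a::metric_space set"
  assumes X: "tds X T" and Z: "Z \<subseteq> X" "analytic_set Z"
  shows "bowen_entropy X T Z = (SUP K\<in>{K. K \<subseteq> Z \<and> compact K}. bowen_entropy X T K)"
proof (rule antisym)
  show "(SUP K\<in>{K. K \<subseteq> Z \<and> compact K}. bowen_entropy X T K) \<le> bowen_entropy X T Z"
    by (auto intro!: SUP_least bowen_entropy_mono)
  show "bowen_entropy X T Z \<le> (SUP K\<in>{K. K \<subseteq> Z \<and> compact K}. bowen_entropy X T K)"
  proof (rule dense_le)
    fix t assume "t < bowen_entropy X T Z"
    then obtain t' where t': "t < t'" "t' < bowen_entropy X T Z" using dense by blast
    then obtain s where s: "t' = ennreal s" "0 \<le> s" by (cases t') auto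
    obtain s0 where s0: "t = ennreal s0" "0 \<le> s0" using t' by (cases t) auto
    have "s0 < s" using t'(1) s s0 by (simp add: ennreal_less_iff)
    then obtain K where "compact K" "K \<subseteq> Z" "t \<le> bowen_entropy X T K"
      using analytic_compact_approximation[OF X Z s0(2)] t'(2) s(1) s0(1) by blast
    then show "t \<le> (SUP K\<in>{K. K \<subseteq> Z \<and> compact K}. bowen_entropy X T K)"
      by (intro SUP_upper2[of K]) auto
  qed
qed

section \<open>The variational principle\<close>

theorem theorem1p2:
  fixes X :: "'a::metric_space set" and T :: "'a \<Rightarrow> 'a"
  assumes "tds X T"
  shows "(\<forall>K. K \<subseteq> X \<and> K \<noteq> {} \<and> compact K \<longrightarrow>
            bowen_entropy X T K =
              (SUP \<mu>\<in>{\<mu> \<in> borel_prob_measures X. measure \<mu> K = 1}. lower_entropy X T \<mu>)) \<and>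
         (top_entropy X T < \<infinity> \<longrightarrow>
           (\<forall>Z. Z \<subseteq> X \<and> analytic_set Z \<longrightarrow>
             bowen_entropy X T Z =
               (SUP K\<in>{K. K \<subseteq> Z \<and> compact K}. bowen_entropy X T K)))"
  using compact_variational_principle[OF assms] analytic_inner_regularity[OF assms] by blast

end
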